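(* (Soundness of the denotational semantics of $\lambda_{\mathsf{fix}}$.) Let $n\in\mathbb N$ and let $e,e'\in\Lambda_n$ be $\lambda_{\mathsf{fix}}$ terms with $n$ free variables such that $e\to e'$ (one reduction step). Then the closed proposition $$\forall\rho:\mathrm{Env}\,n.\ \ \mathrm{interp}_n\,e\ \rho=_{\mathrm{Dom}}\mathrm{thunk}\,(\mathsf{delay}\,(\mathrm{interp}_n\,e'\ \rho))$$ is provable in the guarded logic described in the context from the empty hypothesis context.
   Context: **Model.** $\mathcal T$ is the topos of trees: presheaves $X$ of (small) sets on $\omega$, i.e. sets $X(n)$, $n\ge 0$, with restriction maps $x\mapsto x|_k$ for $k\le n$. $\triangleright X(0)=1$, $\triangleright X(n+1)=X(n)$; its left adjoint is $(\blacktriangleleft X)(n)=X(n+1)$. $\Omega(n)$ is the set of downward closed subsets (sieves) of $\{0,\dots,n\}$, restricted by intersection. **Types.** $\tau,\sigma::=\Delta T\mid\tau\times\sigma\mid\tau\oplus\sigma\mid\tau\to\sigma\mid\triangleright\tau\mid\Omega\mid\mathsf{ax}\,I$, with $T$ a set (a type of the metatheory) and $I$ an object of $\mathcal T$. $[\![\Delta T]\!]$ is the constant presheaf, $[\![\mathsf{ax}\,I]\!]=I$, the others are product, coproduct, exponential, $\triangleright$, subobject classifier of $\mathcal T$. **Terms** (de Bruijn, carrying type annotations, partly suppressed, so that types of terms are unique): $\delta(a)$, $e\odot e'$, $\mathsf{pure}\,e$, $\mathsf{var}(p,q)$, $\mathsf{lam}_\tau e$, $\mathsf{app}\,e\,e'$,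 $\mathsf{delay}\,e$, $\mathsf{adv}_n e$, $\mathsf{fix}\,e$, $\langle e,e'\rangle$, $\mathsf{proj}\,e\,L$, $\mathsf{proj}\,e\,R$, $\mathsf{inl}\,e$, $\mathsf{inr}\,e$, $\mathsf{case}\,e\,f\,g$, $\Phi\wedge\Phi'$, $\Phi\vee\Phi'$, $\Phi\to\Phi'$, $\forall_\tau\Phi$, $\exists_\tau\Phi$, $\mathsf{lift}\,e$, $\top$, $\bot$, $e=_\tau e'$, $\mathsf{ax}_\tau f$ (with $f:1\to[\![\tau]\!]$ in $\mathcal T$). A frame $\Gamma$ is a list of types; a context $\vec\Gamma=\Gamma_0;\dots;\Gamma_n$ is a stack of at least one frame, $\Gamma_0$ innermost; $\cdot$ is the empty frame. Binders $\mathsf{lam},\mathsf{fix},\forall,\exists$ bind slot 0 of the innermost frame; $\mathsf{delay}$ pushes an empty frame. Named variables below abbreviate de Bruijn indices; closed terms may be used in any context. **Typing** $\vec\Gamma\vdash e:\tau$ ($|\vec\Gamma|>0$ always): $\delta(a):\Delta T$ for $a\in T$; $f\odot x:\Delta S$ if $f:\Delta(T\to S)$, $x:\Delta T$; $\mathsf{pure}\,e:\Omega$ if $e:\Delta\mathrm{Prop}$; $\mathsf{ax}_\tau f:\tau$; $\mathsf{var}(p,q)$ has the type of slot $q$ (from 0) of frame $\Gamma_p$; $\Gamma;\vec\Gamma\vdash\mathsf{lam}_\tau e:\tau\to\sigma$ if $(\tau,\Gamma);\vec\Gamma\vdash e:\sigma$; $\vec\Gamma\vdash\mathsf{delay}\,e:\triangleright\tau$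 if $\cdot;\vec\Gamma\vdash e:\tau$; $\Gamma_1;\dots;\Gamma_n;\vec\Gamma\vdash\mathsf{adv}_n e:\tau$ if $n>0$ and $\vec\Gamma\vdash e:\triangleright\tau$; $\Gamma;\vec\Gamma\vdash\mathsf{fix}\,e:\tau$ if $(\triangleright\tau,\Gamma);\vec\Gamma\vdash e:\tau$; $\Gamma;\vec\Gamma\vdash\forall_\tau\Phi,\exists_\tau\Phi:\Omega$ if $(\tau,\Gamma);\vec\Gamma\vdash\Phi:\Omega$; $\mathsf{lift}\,e:\Omega$ if $e:\triangleright\Omega$; $\mathsf{case}\,e\,f\,g:\rho$ if $e:\tau\oplus\sigma$, $f:\tau\to\rho$, $g:\sigma\to\rho$; application, pairs, projections, injections, connectives, $\top,\bot$ and $e=_\tau e':\Omega$ (for $e,e':\tau$) as usual. **Renaming and substitution.** Traverse a term recording the number $d$ of frames entered and, for each entered frame and the original innermost frame, the number of binders passed; $\mathsf{delay}$ raises $d$ by 1; $\mathsf{adv}_m$ with $m\le d$ returns to depth $d-m$ (with that frame's binder count). $\Uparrow^k e$ (weakening past $k$ new frames): $\mathsf{var}(p,q)$ with $p\ge d$ becomes $\mathsf{var}(p+k,q)$; $\mathsf{adv}_m e'$ with $m>d$ becomes $\mathsf{adv}_{m+k}e'$ with $e'$ unchanged; all else is structural. $\uparrow e$ (new slot in the innermost frame): $\mathsf{var}(d,q)$ with $q\ge j$, $j$ the number of binders passed in the original frame, becomes $\mathsf{var}(d,q+1)$; bodies of $\mathsf{adv}_m$ with $m>d$ are unchanged. $e[e']$: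 capture-avoiding substitution for $\mathsf{var}(0,0)$: $\mathsf{var}(d,j)$ becomes $\Uparrow^d\uparrow^j e'$, $\mathsf{var}(d,q)$ with $q>j$ becomes $\mathsf{var}(d,q-1)$; bodies of $\mathsf{adv}_m$ with $m>d$ are unchanged. **Interpretation.** $[\![\Gamma;\vec\Gamma]\!]=[\![\Gamma]\!]\times\blacktriangleleft[\![\vec\Gamma]\!]$, a single frame being the product of its types. A well-typed $e$ is a morphism $[\![e]\!]:[\![\vec\Gamma]\!]\to[\![\tau]\!]$. For $\gamma\in[\![\vec\Gamma]\!](n)$: $\mathsf{var}(p,q)$: the $q$-th component of the part of $\gamma$ in $[\![\Gamma_p]\!](n+p)$, restricted to $n$; $[\![\mathsf{delay}\,e]\!]_0=*$, $[\![\mathsf{delay}\,e]\!]_{n+1}(\gamma)=[\![e]\!]_n( *,\gamma)$; $[\![\mathsf{adv}_k e]\!]_n(\gamma)=[\![e]\!]_{n+1}(\gamma'|_{n+1})$, $\gamma'\in[\![\vec\Gamma]\!](n+k)$ the part of $\gamma$ beyond the first $k$ frames; $[\![\mathsf{fix}\,e]\!]_0(\gamma)=[\![e]\!]_0( *,\gamma)$, $[\![\mathsf{fix}\,e]\!]_{n+1}(\gamma)=[\![e]\!]_{n+1}([\![\mathsf{fix}\,e]\!]_n(\gamma|_n),\gamma)$; $\delta(a)$ constant $a$; $\odot$ application; $\mathsf{ax}_\tau f$ is $f$ after the terminal map; $\mathsf{pure}\,e$ is the full sieve if the truth value is true, else empty; $\mathsf{lift}$ at stage 0 is $\{0\}$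 and at stage $n+1$ sends $S\in\Omega(n)$ to $\{0\}\cup\{k+1:k\in S\}$; $e=_\tau e'$ is $\{k\le n:[\![e]\!]_n(\gamma)|_k=[\![e']\!]_n(\gamma)|_k\}$; connectives, quantifiers, functions, products, sums standard in $\mathcal T$. **Judgmental equality** $\vec\Gamma\vdash e\equiv e':\tau$ (both sides well typed): the least congruence (equivalence relation closed under all term formers, with contexts changing as in typing) containing: $\beta,\eta$ for functions and products; $\mathsf{case}(\mathsf{inl}\,a)fg\equiv fa$, $\mathsf{case}(\mathsf{inr}\,b)fg\equiv gb$; $\delta(f)\odot\delta(x)\equiv\delta(fx)$; $\mathsf{adv}_n(\mathsf{delay}\,e)\equiv\Uparrow^{n-1}e$ ($n>0$, $\cdot;\vec\Gamma\vdash e:\tau$); $e\equiv\mathsf{delay}(\mathsf{adv}_1e)$ at $\triangleright\tau$; $\mathsf{fix}\,e\equiv e[\mathsf{delay}(\Uparrow^1\mathsf{fix}\,e)]$; and $e\equiv e'$ whenever both are well typed and $[\![e]\!]=[\![e']\!]$. **Provability** $\vec\Gamma\mid\vec\Psi\vdash\Phi$, where $\vec\Psi=\Psi_0;\dots;\Psi_n$ is a stack of lists of propositions, $|\vec\Psi|=|\vec\Gamma|$, $\Psi_0$ innermost; displayed formulas and terms are assumed well typed. Write $\blacktriangleright\Phi:=\mathsf{lift}(\mathsf{delay}\,\Phi)$. Rules: (asm) $\Uparrow^k\Phi$ is provable for $\Phi\in\Psi_k$; the usual natural deduction introduction/elimination rules for $\top,\bot,\wedge,\vee,\to$, new hypotheses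 going to the innermost hypothesis frame; usual rules for $\forall_\tau,\exists_\tau$ where the fresh variable extends the innermost frame $\Gamma_0$ and hypotheses in $\Psi_0$ (and the conclusion, in $\exists$-elimination) are weakened by $\uparrow$, instantiation being $\Phi[e]$; from $\Phi[\delta(a)]$ for all $a\in T$ infer $\forall_{\Delta T}\Phi$; sum elimination: for $e:\tau\oplus\sigma$, to prove $\Phi$ it suffices to prove $\uparrow\Phi$ with fresh $x:\tau$ and hypothesis $\uparrow e=\mathsf{inl}\,x$, and with fresh $x:\sigma$ and hypothesis $\uparrow e=\mathsf{inr}\,x$; from $\cdot;\vec\Gamma\mid\cdot;\vec\Psi\vdash\Phi$ infer $\vec\Gamma\mid\vec\Psi\vdash\blacktriangleright\Phi$; from $\vec\Gamma\mid\vec\Psi\vdash\blacktriangleright P$ and $\cdot;\vec\Gamma\mid P;\vec\Psi\vdash Q$ infer $\vec\Gamma\mid\vec\Psi\vdash\blacktriangleright Q$; from $\blacktriangleright P,\blacktriangleright Q$ infer $\blacktriangleright(P\wedge Q)$; from $\blacktriangleright(P\vee Q)$ infer $\blacktriangleright P\vee\blacktriangleright Q$; (Löb) from $\vec\Gamma\mid(\blacktriangleright(\Uparrow^1\Phi),\Psi);\vec\Psi\vdash\Phi$ infer $\vec\Gamma\mid\Psi;\vec\Psi\vdash\Phi$; from $\blacktriangleright(e_1=_\tau e_2)$ infer $\mathsf{delay}\,e_1=_{\triangleright\tau}\mathsf{delay}\,e_2$; from $\vec\Gamma\vdash e_1\equiv e_2:\tau$ infer $e_1=_\tau e_2$; from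 $e_1=_\tau e_2$ and $\Phi[e_1]$ infer $\Phi[e_2]$; if the metatheoretic proposition $P$ holds, infer $\mathsf{pure}\,\delta(P)$; injectivity of $\mathsf{inl},\mathsf{inr}$; from $\mathsf{inl}\,a=\mathsf{inr}\,b$ infer $\bot$. A closed proposition $\Phi$ is provable if $\cdot\mid\cdot\vdash\Phi$. **Object language $\lambda_{\mathsf{fix}}$** (defined inductively in the metatheory). $\Lambda_n$ is the set of terms with variables in $\{0,\dots,n-1\}$ (de Bruijn): $e::=\mathsf{unit}\mid\mathsf{var}\,i\mid\mathsf{app}\,e\,e'\mid\mathsf{lam}\,e\mid\mathsf{fix}\,e$, with bodies of $\mathsf{lam},\mathsf{fix}$ in $\Lambda_{n+1}$. $t[u]$ substitutes $u$ for variable $0$ of $t$. Reduction (least relation): $\mathsf{app}(\mathsf{lam}\,t)u\to t[u]$; $\mathsf{app}\,t\,u\to\mathsf{app}\,t'\,u$ if $t\to t'$; $\mathsf{fix}\,t\to t[\mathsf{fix}\,t]$. **Domain.** Let $\mathcal D$ be the object of $\mathcal T$ (unique up to isomorphism) with $\theta:\Delta\mathbb N+\Delta 1+\triangleright\mathcal D+\triangleright(\mathcal D^{\mathcal D})\cong\mathcal D$; $\mathrm{Dom}:=\mathsf{ax}\,\mathcal D$, with closed constants $\mathrm{MK},\mathrm{PROJ}$ (via $\mathsf{ax}$) denoting $\theta,\theta^{-1}$. $\mathrm{num},\mathrm{error},\mathrm{thunk},\mathrm{lam}$ denote $\mathrm{MK}$ composed with the four injections (from $\Delta\mathbb N$,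 $\Delta1$, $\triangleright\mathrm{Dom}$, $\triangleright(\mathrm{Dom}\to\mathrm{Dom})$); $\mathrm{num}\,0$ means $\mathrm{num}\,\delta(0)$. $\mathrm{apply}:\mathrm{Dom}\to\mathrm{Dom}\to\mathrm{Dom}$ is the closed guarded recursive term $\mathsf{fix}\,\mu.\lambda d.\lambda x.(\cdots)$ which by case analysis on $\mathrm{PROJ}\,d$ returns $\mathrm{error}$ on numbers and on error, $\mathrm{thunk}(\mathsf{delay}((\mathsf{adv}_1\mu)(\mathsf{adv}_1w)\,x))$ on $\mathrm{thunk}\,w$, and $\mathrm{thunk}(\mathsf{delay}((\mathsf{adv}_1g)\,x))$ on $\mathrm{lam}\,g$. **Interpretation of $\lambda_{\mathsf{fix}}$.** $\mathrm{Env}\,0=\Delta1$, $\mathrm{Env}(n+1)=\mathrm{Env}\,n\times\mathrm{Dom}$; $\rho_i$ is the $i$-th entry, $\rho_0$ being the last component added. $\mathrm{interp}_n\,e$ is a closed term of type $\mathrm{Env}\,n\to\mathrm{Dom}$, defined by metatheoretic recursion on $e\in\Lambda_n$: $\mathrm{interp}_n\,\mathsf{unit}=\lambda\rho.\mathrm{num}\,0$; $\mathrm{interp}_n(\mathsf{var}\,i)=\lambda\rho.\rho_i$; $\mathrm{interp}_n(\mathsf{app}\,t\,u)=\lambda\rho.\mathrm{apply}(\mathrm{interp}_n\,t\,\rho)(\mathrm{interp}_n\,u\,\rho)$; $\mathrm{interp}_n(\mathsf{lam}\,t)=\lambda\rho.\mathrm{lam}(\mathsf{delay}(\lambda v.\mathrm{interp}_{n+1}\,t\,\langle\rho,v\rangle))$;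 $\mathrm{interp}_n(\mathsf{fix}\,t)=\lambda\rho.\mathsf{fix}\,y.\,\mathrm{thunk}(\mathsf{delay}(\mathrm{interp}_{n+1}\,t\,\langle\rho,\mathsf{adv}_1y\rangle))$. *)

theory Defs
  imports Main
begin

section \<open>A universe of small sets\<close>

text \<open>
  HOL has no type of all sets. A type of class \<open>universe\<close> is a model of the (second-order) axioms
  of Zermelo--Fraenkel set theory without foundation, \<open>elts x\<close> being the set of members of \<open>x\<close>.
  The small sets are the sets of the form \<open>elts x\<close>. The metatheory of the guarded logic
  (its types, its elements and its functions) is the set theory inside an arbitrary such type.
\<close>

class universe =
  fixes elts :: "'a \<Rightarrow> 'a set"
  assumes zf_ext: "elts x = elts y \<Longrightarrow> x = y"
    and zf_separation: "A \<subseteq> elts x \<Longrightarrow> A \<in> range elts"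
    and zf_union: "(\<Union>y\<in>elts x. elts y) \<in> range elts"
    and zf_powerset: "{y. elts y \<subseteq> elts x} \<in> range elts"
    and zf_replacement: "f ` elts x \<in> range elts"
    and zf_infinity: "range (g :: nat \<Rightarrow> 'a) \<in> range elts"

definition small :: "'u::universe set \<Rightarrow> bool" where
  "small A \<longleftrightarrow> A \<in> range elts"

definition mk :: "'u::universe set \<Rightarrow> 'u" where
  "mk A = (THE x. elts x = A)"

definition pair :: "'u::universe \<Rightarrow> 'u \<Rightarrow> 'u" where
  "pair a b = mk {mk {a}, mk {a, b}}"

definition fstv :: "'u::universe \<Rightarrow> 'u" where
  "fstv p = (THE a. \<exists>b. p = pair a b)"

definition sndv :: "'u::universe \<Rightarrow> 'u" where
  "sndv p = (THE b. \<exists>a. p = pair a b)"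

primrec natv :: "nat \<Rightarrow> 'u::universe" where
  "natv 0 = mk {}"
| "natv (Suc n) = mk {natv n}"

definition inlv :: "'u::universe \<Rightarrow> 'u" where
  "inlv x = pair (natv 0) x"

definition inrv :: "'u::universe \<Rightarrow> 'u" where
  "inrv x = pair (natv 1) x"

definition case_sumv :: "('u::universe \<Rightarrow> 'b) \<Rightarrow> ('u \<Rightarrow> 'b) \<Rightarrow> 'u \<Rightarrow> 'b" where
  "case_sumv f g s = (if \<exists>x. s = inlv x then f (THE x. s = inlv x) else g (THE y. s = inrv y))"

definition fnv :: "'u::universe set \<Rightarrow> ('u \<Rightarrow> 'u) \<Rightarrow> 'u" where
  "fnv A f = mk {pair x (f x) | x. x \<in> A}"

definition applyv :: "'u::universe \<Rightarrow> 'u \<Rightarrow> 'u" where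
  "applyv g x = (THE y. pair x y \<in> elts g)"

definition funset :: "'u::universe \<Rightarrow> 'u \<Rightarrow> 'u" where
  "funset T S = mk {fnv (elts T) f | f. \<forall>x\<in>elts T. f x \<in> elts S}"

definition star :: "'u::universe" where
  "star = mk {}"

definition unit_set :: "'u::universe" where
  "unit_set = mk {star}"

definition nat_set :: "'u::universe" where
  "nat_set = mk (range natv)"

definition truthv :: "bool \<Rightarrow> 'u::universe" where
  "truthv P = (if P then natv 1 else natv 0)"

definition Prop_set :: "'u::universe" where
  "Prop_set = mk (range truthv)"


subsection \<open>Basic facts\<close>

lemma small_elts [simp]: "small (elts x)"
  by (simp add: small_def)

lemma elts_mk [simp]: "small A \<Longrightarrow> elts (mk A) = A"
proof -
  assume "small A"
  then obtain x where x: "elts x = A" by (auto simp: small_def)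
  have "mk A = x"
    unfolding mk_def by (rule the_equality) (use x zf_ext in blast)+
  then show ?thesis using x by simp
qed

lemma mk_elts [simp]: "mk (elts x) = x"
  by (simp add: zf_ext)

lemma mk_inject: "small A \<Longrightarrow> small B \<Longrightarrow> mk A = mk B \<longleftrightarrow> A = B"
  by (metis elts_mk)

lemma smaller: "small B \<Longrightarrow> A \<subseteq> B \<Longrightarrow> small A"
  unfolding small_def using zf_separation by auto

lemma small_image: "small A \<Longrightarrow> small (f ` A)" for f :: "'u::universe \<Rightarrow> 'u"
  unfolding small_def using zf_replacement by auto

lemma small_range_nat: "small (range (g :: nat \<Rightarrow> 'u::universe))"
  unfolding small_def by (rule zf_infinity)

lemma small_UN:
  fixes B :: "'u::universe \<Rightarrow> 'u set"
  assumes "small A" "\<And>x. x \<in> A \<Longrightarrow> small (B x)" shows "small (\<Union>x\<in>A. B x)"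
proof -
  define u where "u = mk ((\<lambda>x. mk (B x)) ` A)"
  have u: "elts u = (\<lambda>x. mk (B x)) ` A"
    using assms(1) by (simp add: u_def small_image)
  have "(\<Union>y\<in>elts u. elts y) = (\<Union>x\<in>A. B x)"
    using assms(2) by (auto simp: u)
  then show ?thesis
    unfolding small_def using zf_union[of u] by simp
qed

lemma small_UN_nat:
  assumes "\<And>k::nat. k \<in> K \<Longrightarrow> small (B k)" shows "small (\<Union>k\<in>K. B k)"
proof -
  define A where "A = (\<lambda>k. mk (B k)) ` K"
  have "small A"
    by (rule smaller[OF small_range_nat[of "\<lambda>k. mk (B k)"]]) (auto simp: A_def)
  then have "small (\<Union>x\<in>A. elts x)" by (rule small_UN) simp
  moreover have "(\<Union>x\<in>A. elts x) = (\<Union>k\<in>K. B k)"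
    using assms by (auto simp: A_def)
  ultimately show ?thesis by simp
qed

lemma small_doubleton: "small {a, b}"
proof -
  have "{a, b} \<subseteq> range (\<lambda>n::nat. if n = 0 then a else b)"
    by (auto simp: image_iff intro: exI[of _ 0] exI[of _ 1])
  then show ?thesis using smaller small_range_nat by blast
qed

lemma small_empty [simp]: "small {}"
  by (rule smaller[OF small_doubleton]) auto

lemma small_singleton [simp]: "small {a}"
  by (rule smaller[OF small_doubleton[of a a]]) auto

lemma small_Un: "small A \<Longrightarrow> small B \<Longrightarrow> small (A \<union> B)"
  using small_UN[OF small_doubleton[of "mk A" "mk B"], of elts] by simp

lemma small_Pow: 
  assumes "small A" shows "small {y. elts y \<subseteq> A}"
  using zf_powerset[of "mk A"] assms by (simp add: small_def[symmetric])

lemma small_Times: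
  assumes "small A" "small B" shows "small {pair x y | x y. x \<in> A \<and> y \<in> B}"
proof -
  have "small (\<Union>x\<in>A. pair x ` B)" by (intro small_UN small_image assms)
  then show ?thesis by (rule smaller) auto
qed

lemma pair_inject [simp]: "pair a b = pair c d \<longleftrightarrow> a = c \<and> b = d"
proof -
  have "mk {a} = mk {c} \<longleftrightarrow> a = c" for a c :: 'a
    by (simp add: mk_inject)
  moreover have "mk {a} = mk {c, d} \<longleftrightarrow> a = c \<and> a = d" for a c d :: 'a
    by (subst mk_inject) (auto simp: small_doubleton)
  moreover have "mk {c, d} = mk {a} \<longleftrightarrow> a = c \<and> a = d" for a c d :: 'a
    by (subst mk_inject) (auto simp: small_doubleton)
  moreover have "mk {a, b} = mk {c, d} \<longleftrightarrow> {a, b} = {c, d}" for a b c d :: 'a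
    by (subst mk_inject) (auto simp: small_doubleton)
  ultimately show ?thesis
    unfolding pair_def
    by (subst mk_inject) (auto simp: small_doubleton doubleton_eq_iff)
qed

lemma fstv_pair [simp]: "fstv (pair a b) = a"
  by (simp add: fstv_def)

lemma sndv_pair [simp]: "sndv (pair a b) = b"
  by (simp add: sndv_def)

lemma natv_inject [simp]: "natv m = natv n \<longleftrightarrow> m = n"
proof (induction m arbitrary: n)
  case 0
  show ?case by (cases n) (simp_all add: mk_inject)
next
  case (Suc m)
  then show ?case by (cases n) (simp_all add: mk_inject)
qed

declare natv.simps [simp del]

lemma inlv_inject [simp]: "inlv x = inlv y \<longleftrightarrow> x = y"
  by (simp add: inlv_def)

lemma inrv_inject [simp]: "inrv x = inrv y \<longleftrightarrow> x = y"
  by (simp add: inrv_def)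

lemma inlv_neq_inrv [simp]: "inlv x \<noteq> inrv y" "inrv y \<noteq> inlv x"
  by (simp_all add: inlv_def inrv_def)

lemma case_sumv_simps [simp]:
  "case_sumv f g (inlv x) = f x" "case_sumv f g (inrv y) = g y"
  by (simp_all add: case_sumv_def)

lemma small_graph: "small A \<Longrightarrow> small {pair x (f x) | x. x \<in> A}"
  by (rule smaller[OF small_image[of A "\<lambda>x. pair x (f x)"]]) auto

lemma applyv_fnv [simp]: "small A \<Longrightarrow> x \<in> A \<Longrightarrow> applyv (fnv A f) x = f x"
  by (simp add: applyv_def fnv_def small_graph)

lemma fnv_eq_iff:
  assumes "small A" shows "fnv A f = fnv A g \<longleftrightarrow> (\<forall>x\<in>A. f x = g x)"
proof
  show "fnv A f = fnv A g \<Longrightarrow> \<forall>x\<in>A. f x = g x"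
    by (metis applyv_fnv[OF assms])
next
  assume "\<forall>x\<in>A. f x = g x"
  then have "{pair x (f x) | x. x \<in> A} = {pair x (g x) | x. x \<in> A}" by auto
  then show "fnv A f = fnv A g" by (simp add: fnv_def)
qed

lemma elts_funset [simp]:
  "elts (funset T S) = {fnv (elts T) f | f. \<forall>x\<in>elts T. f x \<in> elts S}"
proof -
  let ?P = "{pair x y | x y. x \<in> elts T \<and> y \<in> elts S}"
  have "small {y. elts y \<subseteq> ?P}" by (intro small_Pow small_Times) simp_all
  then have "small {fnv (elts T) f | f. \<forall>x\<in>elts T. f x \<in> elts S}"
    by (rule smaller) (auto simp: fnv_def small_graph)
  then show ?thesis by (simp add: funset_def)
qed

lemma elts_unit_set [simp]: "elts unit_set = {star}"
  by (simp add: unit_set_def)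

lemma elts_nat_set [simp]: "elts nat_set = range natv"
  by (simp add: nat_set_def small_range_nat)

lemma truthv_inject [simp]: "truthv P = truthv Q \<longleftrightarrow> P = Q"
  by (simp add: truthv_def)

lemma elts_Prop_set [simp]: "elts Prop_set = range truthv"
  by (simp add: Prop_set_def UNIV_bool small_doubleton)


section \<open>The topos of trees\<close>

definition functorial :: "(nat \<Rightarrow> 'u::universe set) \<Rightarrow> (nat \<Rightarrow> nat \<Rightarrow> 'u \<Rightarrow> 'u) \<Rightarrow> bool" where
  "functorial X r \<longleftrightarrow>
     (\<forall>n. small (X n)) \<and>
     (\<forall>n k x. k \<le> n \<longrightarrow> x \<in> X n \<longrightarrow> r n k x \<in> X k) \<and>
     (\<forall>n x. x \<in> X n \<longrightarrow> r n n x = x) \<and>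
     (\<forall>n m k x. k \<le> m \<longrightarrow> m \<le> n \<longrightarrow> x \<in> X n \<longrightarrow> r m k (r n m x) = r n k x)"

text \<open>The restriction maps are fixed outside their domains, so that equality of objects is the
  intended one.\<close>

typedef (overloaded) ('u::universe) obj =
  "{(X :: nat \<Rightarrow> 'u set, r :: nat \<Rightarrow> nat \<Rightarrow> 'u \<Rightarrow> 'u). functorial X r \<and>
      (\<forall>n k x. \<not> (k \<le> n \<and> x \<in> X n) \<longrightarrow> r n k x = undefined)}"
  by (rule exI[of _ "(\<lambda>_. {}, \<lambda>_ _ _. undefined)"]) (simp add: functorial_def)

definition ob :: "'u::universe obj \<Rightarrow> nat \<Rightarrow> 'u set" where
  "ob X = fst (Rep_obj X)"

definition res :: "'u::universe obj \<Rightarrow> nat \<Rightarrow> nat \<Rightarrow> 'u \<Rightarrow> 'u" where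
  "res X = snd (Rep_obj X)"

definition mk_obj :: "(nat \<Rightarrow> 'u::universe set) \<Rightarrow> (nat \<Rightarrow> nat \<Rightarrow> 'u \<Rightarrow> 'u) \<Rightarrow> 'u obj" where
  "mk_obj X r = Abs_obj (X, \<lambda>n k x. if k \<le> n \<and> x \<in> X n then r n k x else undefined)"

definition const_obj :: "'u::universe \<Rightarrow> 'u obj" where
  "const_obj T = mk_obj (\<lambda>n. elts T) (\<lambda>n k x. x)"

definition prod_obj :: "'u::universe obj \<Rightarrow> 'u obj \<Rightarrow> 'u obj" where
  "prod_obj X Y = mk_obj (\<lambda>n. {pair x y | x y. x \<in> ob X n \<and> y \<in> ob Y n})
     (\<lambda>n k p. pair (res X n k (fstv p)) (res Y n k (sndv p)))"

definition sum_obj :: "'u::universe obj \<Rightarrow> 'u obj \<Rightarrow> 'u obj" where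
  "sum_obj X Y = mk_obj (\<lambda>n. inlv ` ob X n \<union> inrv ` ob Y n)
     (\<lambda>n k. case_sumv (\<lambda>x. inlv (res X n k x)) (\<lambda>y. inrv (res Y n k y)))"

definition later_obj :: "'u::universe obj \<Rightarrow> 'u obj" where
  "later_obj X = mk_obj (\<lambda>n. case n of 0 \<Rightarrow> {star} | Suc m \<Rightarrow> ob X m)
     (\<lambda>n k x. case k of 0 \<Rightarrow> star | Suc j \<Rightarrow> res X (n - 1) j x)"

text \<open>An element at stage \<open>n\<close> of the exponential is a natural family \<open>\<phi> k : X k \<Rightarrow> Y k\<close> for
  \<open>k \<le> n\<close>, encoded as the graph of \<open>(k, x) \<mapsto> \<phi> k x\<close>.\<close>

definition famv :: "'u::universe obj \<Rightarrow> nat \<Rightarrow> (nat \<Rightarrow> 'u \<Rightarrow> 'u) \<Rightarrow> 'u" where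
  "famv X n \<phi> = mk {pair (pair (natv k) x) (\<phi> k x) | k x. k \<le> n \<and> x \<in> ob X k}"

definition evalv :: "'u::universe \<Rightarrow> nat \<Rightarrow> 'u \<Rightarrow> 'u" where
  "evalv g k x = applyv g (pair (natv k) x)"

definition natural_upto ::
  "'u::universe obj \<Rightarrow> 'u obj \<Rightarrow> nat \<Rightarrow> (nat \<Rightarrow> 'u \<Rightarrow> 'u) \<Rightarrow> bool" where
  "natural_upto X Y n \<phi> \<longleftrightarrow>
     (\<forall>k\<le>n. \<forall>x\<in>ob X k. \<phi> k x \<in> ob Y k) \<and>
     (\<forall>k\<le>n. \<forall>j\<le>k. \<forall>x\<in>ob X k. \<phi> j (res X k j x) = res Y k j (\<phi> k x))"

definition exp_obj :: "'u::universe obj \<Rightarrow> 'u obj \<Rightarrow> 'u obj" where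
  "exp_obj X Y = mk_obj (\<lambda>n. {famv X n \<phi> | \<phi>. natural_upto X Y n \<phi>})
     (\<lambda>n k g. famv X k (evalv g))"

definition sievev :: "nat set \<Rightarrow> 'u::universe" where
  "sievev S = mk (natv ` S)"

definition sieve_of :: "'u::universe \<Rightarrow> nat set" where
  "sieve_of s = {k. natv k \<in> elts s}"

definition Omega_obj :: "'u::universe obj" where
  "Omega_obj = mk_obj
     (\<lambda>n. {sievev S | S. S \<subseteq> {..n} \<and> (\<forall>k\<in>S. \<forall>j\<le>k. j \<in> S)})
     (\<lambda>n k s. sievev (sieve_of s \<inter> {..k}))"

definition global_element :: "'u::universe obj \<Rightarrow> (nat \<Rightarrow> 'u) \<Rightarrow> bool" where
  "global_element X f \<longleftrightarrow> (\<forall>n. f n \<in> ob X n) \<and> (\<forall>n. \<forall>k\<le>n. res X n k (f n) = f k)"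

definition obj_iso :: "'u::universe obj \<Rightarrow> 'u obj \<Rightarrow> (nat \<Rightarrow> 'u \<Rightarrow> 'u) \<Rightarrow> bool" where
  "obj_iso X Y \<theta> \<longleftrightarrow>
     (\<forall>n. bij_betw (\<theta> n) (ob X n) (ob Y n)) \<and>
     (\<forall>n. \<forall>k\<le>n. \<forall>x\<in>ob X n. \<theta> k (res X n k x) = res Y n k (\<theta> n x))"


subsection \<open>The constructions are presheaves\<close>

lemma functorial_obj [simp]: "functorial (ob X) (res X)"
  using Rep_obj[of X] by (auto simp: ob_def res_def)

lemma small_ob [simp]: "small (ob X n)"
  using functorial_obj[of X] by (simp add: functorial_def)

lemma res_in [simp]: "k \<le> n \<Longrightarrow> x \<in> ob X n \<Longrightarrow> res X n k x \<in> ob X k"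
  using functorial_obj[of X] by (simp add: functorial_def)

lemma res_id [simp]: "x \<in> ob X n \<Longrightarrow> res X n n x = x"
  using functorial_obj[of X] by (simp add: functorial_def)

lemma res_res [simp]:
  "k \<le> m \<Longrightarrow> m \<le> n \<Longrightarrow> x \<in> ob X n \<Longrightarrow> res X m k (res X n m x) = res X n k x"
  using functorial_obj[of X] by (simp add: functorial_def)

lemma mk_obj_Rep:
  assumes "functorial X r"
  shows "Rep_obj (mk_obj X r) = (X, \<lambda>n k x. if k \<le> n \<and> x \<in> X n then r n k x else undefined)"
  unfolding mk_obj_def
  by (rule Abs_obj_inverse) (use assms in \<open>auto simp: functorial_def\<close>)

lemma ob_mk_obj: "functorial X r \<Longrightarrow> ob (mk_obj X r) n = X n"
  by (simp add: ob_def mk_obj_Rep)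

lemma res_mk_obj: "functorial X r \<Longrightarrow> k \<le> n \<Longrightarrow> x \<in> X n \<Longrightarrow> res (mk_obj X r) n k x = r n k x"
  by (simp add: res_def mk_obj_Rep)

lemma const_functorial: "functorial (\<lambda>n. elts T) (\<lambda>n k x. x)"
  by (simp add: functorial_def)

lemma ob_const [simp]: "ob (const_obj T) n = elts T"
  by (simp add: const_obj_def ob_mk_obj const_functorial)

lemma res_const [simp]: "k \<le> n \<Longrightarrow> x \<in> elts T \<Longrightarrow> res (const_obj T) n k x = x"
  by (simp add: const_obj_def res_mk_obj const_functorial)

lemma prod_functorial: "functorial (\<lambda>n. {pair x y | x y. x \<in> ob X n \<and> y \<in> ob Y n})
     (\<lambda>n k p. pair (res X n k (fstv p)) (res Y n k (sndv p)))"
  unfolding functorial_def by (auto simp: small_Times)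

lemma ob_prod [simp]: "ob (prod_obj X Y) n = {pair x y | x y. x \<in> ob X n \<and> y \<in> ob Y n}"
  by (simp add: prod_obj_def ob_mk_obj prod_functorial)

lemma res_prod [simp]: "k \<le> n \<Longrightarrow> x \<in> ob X n \<Longrightarrow> y \<in> ob Y n \<Longrightarrow>
    res (prod_obj X Y) n k (pair x y) = pair (res X n k x) (res Y n k y)"
  by (simp add: prod_obj_def res_mk_obj[OF prod_functorial])

lemma sum_functorial: "functorial (\<lambda>n. inlv ` ob X n \<union> inrv ` ob Y n)
     (\<lambda>n k. case_sumv (\<lambda>x. inlv (res X n k x)) (\<lambda>y. inrv (res Y n k y)))"
  unfolding functorial_def by (auto simp: small_Un small_image)

lemma ob_sum [simp]: "ob (sum_obj X Y) n = inlv ` ob X n \<union> inrv ` ob Y n"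
  by (simp add: sum_obj_def ob_mk_obj sum_functorial)

lemma res_sum_inl [simp]: "k \<le> n \<Longrightarrow> x \<in> ob X n \<Longrightarrow>
    res (sum_obj X Y) n k (inlv x) = inlv (res X n k x)"
  by (simp add: sum_obj_def res_mk_obj[OF sum_functorial])

lemma res_sum_inr [simp]: "k \<le> n \<Longrightarrow> y \<in> ob Y n \<Longrightarrow>
    res (sum_obj X Y) n k (inrv y) = inrv (res Y n k y)"
  by (simp add: sum_obj_def res_mk_obj[OF sum_functorial])

lemma later_functorial: "functorial (\<lambda>n. case n of 0 \<Rightarrow> {star} | Suc m \<Rightarrow> ob X m)
     (\<lambda>n k x. case k of 0 \<Rightarrow> star | Suc j \<Rightarrow> res X (n - 1) j x)"
  unfolding functorial_def by (auto split: nat.splits simp: Suc_le_eq)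

lemma ob_later [simp]: 
  "ob (later_obj X) 0 = {star}" "ob (later_obj X) (Suc n) = ob X n"
  by (simp_all add: later_obj_def ob_mk_obj later_functorial)

lemma res_later_0 [simp]: "x \<in> ob (later_obj X) n \<Longrightarrow> res (later_obj X) n 0 x = star"
  by (simp add: later_obj_def res_mk_obj[OF later_functorial] ob_mk_obj[OF later_functorial])

lemma res_later_Suc [simp]: "k \<le> n \<Longrightarrow> x \<in> ob X n \<Longrightarrow>
    res (later_obj X) (Suc n) (Suc k) x = res X n k x"
  by (simp add: later_obj_def res_mk_obj[OF later_functorial])

lemma small_fam: "small {pair (pair (natv k) x) (\<phi> k x) | k x. k \<le> n \<and> x \<in> ob X k}"
proof -
  have "small (\<Union>k\<in>{..n}. (\<lambda>x. pair (pair (natv k) x) (\<phi> k x)) ` ob X k)"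
    by (intro small_UN_nat small_image) simp
  then show ?thesis by (rule smaller) auto
qed

lemma evalv_famv [simp]: "k \<le> n \<Longrightarrow> x \<in> ob X k \<Longrightarrow> evalv (famv X n \<phi>) k x = \<phi> k x"
  by (simp add: evalv_def applyv_def famv_def small_fam)

lemma famv_eq_iff: "famv X n \<phi> = famv X n \<psi> \<longleftrightarrow> (\<forall>k\<le>n. \<forall>x\<in>ob X k. \<phi> k x = \<psi> k x)"
proof
  show "famv X n \<phi> = famv X n \<psi> \<Longrightarrow> \<forall>k\<le>n. \<forall>x\<in>ob X k. \<phi> k x = \<psi> k x"
    by (metis evalv_famv)
next
  assume "\<forall>k\<le>n. \<forall>x\<in>ob X k. \<phi> k x = \<psi> k x"
  then have "{pair (pair (natv k) x) (\<phi> k x) | k x. k \<le> n \<and> x \<in> ob X k} =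
      {pair (pair (natv k) x) (\<psi> k x) | k x. k \<le> n \<and> x \<in> ob X k}"
    by auto
  then show "famv X n \<phi> = famv X n \<psi>" by (simp add: famv_def)
qed

lemma natural_upto_mono: "natural_upto X Y n \<phi> \<Longrightarrow> k \<le> n \<Longrightarrow> natural_upto X Y k \<phi>"
  by (simp add: natural_upto_def)

lemma small_exp: "small {famv X n \<phi> | \<phi>. natural_upto X Y n \<phi>}"
proof -
  let ?A = "\<Union>k\<in>{..n}. pair (natv k) ` ob X k" and ?B = "\<Union>k\<in>{..n}. ob Y k"
  have "small {y. elts y \<subseteq> {pair a b | a b. a \<in> ?A \<and> b \<in> ?B}}"
    by (intro small_Pow small_Times small_UN_nat small_image) simp_all
  then show ?thesis
    by (rule smaller) (fastforce simp: famv_def small_fam natural_upto_def)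
qed

lemma exp_functorial: "functorial (\<lambda>n. {famv X n \<phi> | \<phi>. natural_upto X Y n \<phi>})
     (\<lambda>n k g. famv X k (evalv g))"
proof -
  have *: "famv X k (evalv (famv X n \<phi>)) = famv X k \<phi>" if "k \<le> n" for k n \<phi>
    using that by (simp add: famv_eq_iff)
  show ?thesis
    unfolding functorial_def by (auto simp: small_exp * intro: natural_upto_mono)
qed

lemma ob_exp [simp]: "ob (exp_obj X Y) n = {famv X n \<phi> | \<phi>. natural_upto X Y n \<phi>}"
  by (simp add: exp_obj_def ob_mk_obj exp_functorial)

lemma res_exp: "k \<le> n \<Longrightarrow> g \<in> ob (exp_obj X Y) n \<Longrightarrow>
    res (exp_obj X Y) n k g = famv X k (evalv g)"
  unfolding exp_obj_def
  by (rule res_mk_obj[OF exp_functorial]) (simp_all add: ob_mk_obj[OF exp_functorial])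

lemma res_exp_famv [simp]: "k \<le> n \<Longrightarrow> natural_upto X Y n \<phi> \<Longrightarrow>
    res (exp_obj X Y) n k (famv X n \<phi>) = famv X k \<phi>"
  by (subst res_exp) (auto simp: famv_eq_iff)

lemma small_natv_image [simp]: "small (natv ` S)"
  by (rule smaller[OF small_range_nat]) blast

lemma sieve_of_sievev [simp]: "sieve_of (sievev S) = S"
  by (auto simp: sieve_of_def sievev_def)

lemma sievev_inject [simp]: "sievev S = sievev S' \<longleftrightarrow> S = S'"
  by (metis sieve_of_sievev)

lemma Omega_functorial: "functorial
     (\<lambda>n. {sievev S | S. S \<subseteq> {..n} \<and> (\<forall>k\<in>S. \<forall>j\<le>k. j \<in> S)})
     (\<lambda>n k s. sievev (sieve_of s \<inter> {..k}))"
proof -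
  have "small {sievev S | S. S \<subseteq> {..n} \<and> (\<forall>k\<in>S. \<forall>j\<le>k. j \<in> S)}" for n
    by (rule smaller[OF small_Pow[OF small_range_nat[of natv]]]) (auto simp: sievev_def)
  then show ?thesis
    unfolding functorial_def by (auto intro!: exI arg_cong[of _ _ sievev])
qed

lemma ob_Omega [simp]:
  "ob Omega_obj n = {sievev S | S. S \<subseteq> {..n} \<and> (\<forall>k\<in>S. \<forall>j\<le>k. j \<in> S)}"
  by (simp add: Omega_obj_def ob_mk_obj Omega_functorial)

lemma res_Omega: "k \<le> n \<Longrightarrow> s \<in> ob Omega_obj n \<Longrightarrow>
    res Omega_obj n k s = sievev (sieve_of s \<inter> {..k})"
  unfolding Omega_obj_def
  by (rule res_mk_obj[OF Omega_functorial]) (simp_all add: ob_mk_obj[OF Omega_functorial])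


section \<open>Types and terms of the guarded logic\<close>

declare [[typedef_overloaded]]

datatype ('u::universe) ty =
    TDelta 'u
  | TProd "'u ty" "'u ty"
  | TSum "'u ty" "'u ty"
  | TFun "'u ty" "'u ty"
  | TLater "'u ty"
  | TOmega
  | TAx "'u obj"

primrec ty_sem :: "'u::universe ty \<Rightarrow> 'u obj" where
  "ty_sem (TDelta T) = const_obj T"
| "ty_sem (TProd \<tau> \<sigma>) = prod_obj (ty_sem \<tau>) (ty_sem \<sigma>)"
| "ty_sem (TSum \<tau> \<sigma>) = sum_obj (ty_sem \<tau>) (ty_sem \<sigma>)"
| "ty_sem (TFun \<tau> \<sigma>) = exp_obj (ty_sem \<tau>) (ty_sem \<sigma>)"
| "ty_sem (TLater \<tau>) = later_obj (ty_sem \<tau>)"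
| "ty_sem TOmega = Omega_obj"
| "ty_sem (TAx I) = I"

datatype side = L | R

text \<open>The type annotations make types of terms unique. In \<open>Inl \<sigma> e : \<tau> \<oplus> \<sigma>\<close> and
  \<open>Inr \<tau> e : \<tau> \<oplus> \<sigma>\<close> the annotation is the type of the other summand; \<open>Odot T S f x\<close> needs both
  annotations because \<open>funset\<close> is not injective.\<close>

datatype ('u::universe) tm =
    Dl 'u 'u
  | Odot 'u 'u "'u tm" "'u tm"
  | Pure "'u tm"
  | Var nat nat
  | Lam "'u ty" "'u tm"
  | App "'u tm" "'u tm"
  | Delay "'u tm"
  | Adv nat "'u tm"
  | Fix "'u ty" "'u tm"
  | Pair "'u tm" "'u tm"
  | Proj "'u tm" side
  | Inl "'u ty" "'u tm"
  | Inr "'u ty" "'u tm"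
  | Case "'u tm" "'u tm" "'u tm"
  | And "'u tm" "'u tm"
  | Or "'u tm" "'u tm"
  | Imp "'u tm" "'u tm"
  | All "'u ty" "'u tm"
  | Ex "'u ty" "'u tm"
  | Lift "'u tm"
  | Top
  | Bot
  | Eq "'u ty" "'u tm" "'u tm"
  | AxTm "'u ty" "nat \<Rightarrow> 'u"

type_synonym 'u ctx = "'u ty list list"

inductive typed :: "'u::universe ctx \<Rightarrow> 'u tm \<Rightarrow> 'u ty \<Rightarrow> bool" where
  t_Dl: "G \<noteq> [] \<Longrightarrow> a \<in> elts T \<Longrightarrow> typed G (Dl T a) (TDelta T)"
| t_Odot: "typed G f (TDelta (funset T S)) \<Longrightarrow> typed G x (TDelta T) \<Longrightarrow>
    typed G (Odot T S f x) (TDelta S)"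
| t_Pure: "typed G e (TDelta Prop_set) \<Longrightarrow> typed G (Pure e) TOmega"
| t_Var: "p < length G \<Longrightarrow> q < length (G ! p) \<Longrightarrow> typed G (Var p q) (G ! p ! q)"
| t_Lam: "typed ((\<tau> # \<Gamma>) # G) e \<sigma> \<Longrightarrow> typed (\<Gamma> # G) (Lam \<tau> e) (TFun \<tau> \<sigma>)"
| t_App: "typed G f (TFun \<tau> \<sigma>) \<Longrightarrow> typed G e \<tau> \<Longrightarrow> typed G (App f e) \<sigma>"
| t_Delay: "G \<noteq> [] \<Longrightarrow> typed ([] # G) e \<tau> \<Longrightarrow> typed G (Delay e) (TLater \<tau>)"
| t_Adv: "0 < n \<Longrightarrow> n < length G \<Longrightarrow> typed (drop n G) e (TLater \<tau>) \<Longrightarrow> typed G (Adv n e) \<tau>"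
| t_Fix: "typed ((TLater \<tau> # \<Gamma>) # G) e \<tau> \<Longrightarrow> typed (\<Gamma> # G) (Fix \<tau> e) \<tau>"
| t_Pair: "typed G e \<tau> \<Longrightarrow> typed G e' \<sigma> \<Longrightarrow> typed G (Pair e e') (TProd \<tau> \<sigma>)"
| t_ProjL: "typed G e (TProd \<tau> \<sigma>) \<Longrightarrow> typed G (Proj e L) \<tau>"
| t_ProjR: "typed G e (TProd \<tau> \<sigma>) \<Longrightarrow> typed G (Proj e R) \<sigma>"
| t_Inl: "typed G e \<tau> \<Longrightarrow> typed G (Inl \<sigma> e) (TSum \<tau> \<sigma>)"
| t_Inr: "typed G e \<sigma> \<Longrightarrow> typed G (Inr \<tau> e) (TSum \<tau> \<sigma>)"
| t_Case: "typed G e (TSum \<tau> \<sigma>) \<Longrightarrow> typed G f (TFun \<tau> \<rho>) \<Longrightarrow> typed G g (TFun \<sigma> \<rho>) \<Longrightarrow>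
    typed G (Case e f g) \<rho>"
| t_And: "typed G P TOmega \<Longrightarrow> typed G Q TOmega \<Longrightarrow> typed G (And P Q) TOmega"
| t_Or: "typed G P TOmega \<Longrightarrow> typed G Q TOmega \<Longrightarrow> typed G (Or P Q) TOmega"
| t_Imp: "typed G P TOmega \<Longrightarrow> typed G Q TOmega \<Longrightarrow> typed G (Imp P Q) TOmega"
| t_All: "typed ((\<tau> # \<Gamma>) # G) P TOmega \<Longrightarrow> typed (\<Gamma> # G) (All \<tau> P) TOmega"
| t_Ex: "typed ((\<tau> # \<Gamma>) # G) P TOmega \<Longrightarrow> typed (\<Gamma> # G) (Ex \<tau> P) TOmega"
| t_Lift: "typed G e (TLater TOmega) \<Longrightarrow> typed G (Lift e) TOmega"
| t_Top: "G \<noteq> [] \<Longrightarrow> typed G Top TOmega"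
| t_Bot: "G \<noteq> [] \<Longrightarrow> typed G Bot TOmega"
| t_Eq: "typed G e \<tau> \<Longrightarrow> typed G e' \<tau> \<Longrightarrow> typed G (Eq \<tau> e e') TOmega"
| t_AxTm: "G \<noteq> [] \<Longrightarrow> global_element (ty_sem \<tau>) f \<Longrightarrow> typed G (AxTm \<tau> f) \<tau>"


section \<open>Renaming and substitution\<close>

text \<open>
  The traversal state \<open>bs\<close> lists the numbers of binders passed, for the frames entered and the
  original innermost frame, current frame first; thus \<open>length bs = d + 1\<close> and \<open>last bs\<close> belongs to
  the original innermost frame. \<open>V bs p q\<close> is the image of \<open>Var p q\<close>, and \<open>a\<close> is added to \<open>m\<close>
  in those \<open>Adv m\<close> that leave the original innermost frame.
\<close>

definition bump :: "nat list \<Rightarrow> nat list" where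
  "bump bs = Suc (hd bs) # tl bs"

primrec trav :: "(nat list \<Rightarrow> nat \<Rightarrow> nat \<Rightarrow> 'u tm) \<Rightarrow> nat \<Rightarrow> nat list \<Rightarrow> 'u::universe tm \<Rightarrow> 'u tm" where
  "trav V a bs (Dl T x) = Dl T x"
| "trav V a bs (Odot T S f x) = Odot T S (trav V a bs f) (trav V a bs x)"
| "trav V a bs (Pure e) = Pure (trav V a bs e)"
| "trav V a bs (Var p q) = V bs p q"
| "trav V a bs (Lam \<tau> e) = Lam \<tau> (trav V a (bump bs) e)"
| "trav V a bs (App f e) = App (trav V a bs f) (trav V a bs e)"
| "trav V a bs (Delay e) = Delay (trav V a (0 # bs) e)"
| "trav V a bs (Adv m e) =
     (if m < length bs then Adv m (trav V a (drop m bs) e) else Adv (m + a) e)"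
| "trav V a bs (Fix \<tau> e) = Fix \<tau> (trav V a (bump bs) e)"
| "trav V a bs (Pair e e') = Pair (trav V a bs e) (trav V a bs e')"
| "trav V a bs (Proj e s) = Proj (trav V a bs e) s"
| "trav V a bs (Inl \<sigma> e) = Inl \<sigma> (trav V a bs e)"
| "trav V a bs (Inr \<tau> e) = Inr \<tau> (trav V a bs e)"
| "trav V a bs (Case e f g) = Case (trav V a bs e) (trav V a bs f) (trav V a bs g)"
| "trav V a bs (And P Q) = And (trav V a bs P) (trav V a bs Q)"
| "trav V a bs (Or P Q) = Or (trav V a bs P) (trav V a bs Q)"
| "trav V a bs (Imp P Q) = Imp (trav V a bs P) (trav V a bs Q)"
| "trav V a bs (All \<tau> P) = All \<tau> (trav V a (bump bs) P)"
| "trav V a bs (Ex \<tau> P) = Ex \<tau> (trav V a (bump bs) P)"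
| "trav V a bs (Lift e) = Lift (trav V a bs e)"
| "trav V a bs Top = Top"
| "trav V a bs Bot = Bot"
| "trav V a bs (Eq \<tau> e e') = Eq \<tau> (trav V a bs e) (trav V a bs e')"
| "trav V a bs (AxTm \<tau> f) = AxTm \<tau> f"

text \<open>
  Weakening past \<open>k\<close> new frames. For \<open>k > 0\<close> the \<open>j = last bs\<close> binders passed in the original
  innermost frame now belong to the first new frame: the variables they bind stay put, and a free
  slot \<open>q \<ge> j\<close> of the original innermost frame is slot \<open>q - j\<close> of that frame after weakening.
\<close>

definition wk :: "nat \<Rightarrow> 'u::universe tm \<Rightarrow> 'u tm" where
  "wk k e = (if k = 0 then e else
     trav (\<lambda>bs p q. let d = length bs - 1; j = last bs in
         if p < d \<or> p = d \<and> q < j then Var p q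
         else if p = d then Var (p + k) (q - j)
         else Var (p + k) q) k [0] e)"

definition up :: "'u::universe tm \<Rightarrow> 'u tm" where
  "up e = trav (\<lambda>bs p q. let d = length bs - 1; j = last bs in
         if p = d \<and> q \<ge> j then Var p (Suc q) else Var p q) 0 [0] e"

definition subst :: "'u::universe tm \<Rightarrow> 'u tm \<Rightarrow> 'u tm" where
  "subst e e' = trav (\<lambda>bs p q. let d = length bs - 1; j = last bs in
         if p = d \<and> q = j then wk d ((up ^^ j) e')
         else if p = d \<and> q > j then Var p (q - 1)
         else Var p q) 0 [0] e"


section \<open>Interpretation\<close>

text \<open>An element of a context at stage \<open>n\<close> is a stack of lists of values, the \<open>p\<close>-th list
  consisting of elements at stage \<open>n + p\<close>.\<close>

type_synonym 'u env = "'u list list"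

primrec ctx_sem :: "'u::universe ctx \<Rightarrow> nat \<Rightarrow> 'u env set" where
  "ctx_sem [] n = {[]}"
| "ctx_sem (\<Gamma> # G) n =
     {xs # \<gamma> | xs \<gamma>. list_all2 (\<lambda>x \<tau>. x \<in> ob (ty_sem \<tau>) n) xs \<Gamma> \<and> \<gamma> \<in> ctx_sem G (Suc n)}"

primrec ctx_res :: "'u::universe ctx \<Rightarrow> nat \<Rightarrow> nat \<Rightarrow> 'u env \<Rightarrow> 'u env" where
  "ctx_res [] n k \<gamma> = []"
| "ctx_res (\<Gamma> # G) n k \<gamma> =
     map2 (\<lambda>\<tau> x. res (ty_sem \<tau>) n k x) \<Gamma> (hd \<gamma>) # ctx_res G (Suc n) (Suc k) (tl \<gamma>)"

definition push :: "'a \<Rightarrow> 'a list list \<Rightarrow> 'a list list" where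
  "push x \<gamma> = (x # hd \<gamma>) # tl \<gamma>"

primrec fix_sem :: "(nat \<Rightarrow> 'u env \<Rightarrow> 'u) \<Rightarrow> 'u::universe ctx \<Rightarrow> nat \<Rightarrow> 'u env \<Rightarrow> 'u" where
  "fix_sem F G 0 \<gamma> = F 0 (push star \<gamma>)"
| "fix_sem F G (Suc n) \<gamma> = F (Suc n) (push (fix_sem F G n (ctx_res G (Suc n) n \<gamma>)) \<gamma>)"

primrec tm_sem :: "'u::universe tm \<Rightarrow> 'u ctx \<Rightarrow> nat \<Rightarrow> 'u env \<Rightarrow> 'u" where
  "tm_sem (Dl T a) G n \<gamma> = a"
| "tm_sem (Odot T S f x) G n \<gamma> = applyv (tm_sem f G n \<gamma>) (tm_sem x G n \<gamma>)"
| "tm_sem (Pure e) G n \<gamma> = sievev (if tm_sem e G n \<gamma> = truthv True then {..n} else {})"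
| "tm_sem (Var p q) G n \<gamma> = res (ty_sem (G ! p ! q)) (n + p) n (\<gamma> ! p ! q)"
| "tm_sem (Lam \<tau> e) G n \<gamma> =
     famv (ty_sem \<tau>) n (\<lambda>k x. tm_sem e (push \<tau> G) k (push x (ctx_res G n k \<gamma>)))"
| "tm_sem (App f e) G n \<gamma> = evalv (tm_sem f G n \<gamma>) n (tm_sem e G n \<gamma>)"
| "tm_sem (Delay e) G n \<gamma> = (case n of 0 \<Rightarrow> star | Suc m \<Rightarrow> tm_sem e ([] # G) m ([] # \<gamma>))"
| "tm_sem (Adv k e) G n \<gamma> =
     tm_sem e (drop k G) (Suc n) (ctx_res (drop k G) (n + k) (Suc n) (drop k \<gamma>))"
| "tm_sem (Fix \<tau> e) G n \<gamma> = fix_sem (tm_sem e (push (TLater \<tau>) G)) G n \<gamma>"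
| "tm_sem (Pair e e') G n \<gamma> = pair (tm_sem e G n \<gamma>) (tm_sem e' G n \<gamma>)"
| "tm_sem (Proj e s) G n \<gamma> =
     (case s of L \<Rightarrow> fstv (tm_sem e G n \<gamma>) | R \<Rightarrow> sndv (tm_sem e G n \<gamma>))"
| "tm_sem (Inl \<sigma> e) G n \<gamma> = inlv (tm_sem e G n \<gamma>)"
| "tm_sem (Inr \<tau> e) G n \<gamma> = inrv (tm_sem e G n \<gamma>)"
| "tm_sem (Case e f g) G n \<gamma> =
     case_sumv (evalv (tm_sem f G n \<gamma>) n) (evalv (tm_sem g G n \<gamma>) n) (tm_sem e G n \<gamma>)"
| "tm_sem (And P Q) G n \<gamma> = sievev (sieve_of (tm_sem P G n \<gamma>) \<inter> sieve_of (tm_sem Q G n \<gamma>))"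
| "tm_sem (Or P Q) G n \<gamma> = sievev (sieve_of (tm_sem P G n \<gamma>) \<union> sieve_of (tm_sem Q G n \<gamma>))"
| "tm_sem (Imp P Q) G n \<gamma> = sievev {k. k \<le> n \<and>
     (\<forall>j\<le>k. j \<in> sieve_of (tm_sem P G n \<gamma>) \<longrightarrow> j \<in> sieve_of (tm_sem Q G n \<gamma>))}"
| "tm_sem (All \<tau> P) G n \<gamma> = sievev {k. k \<le> n \<and>
     (\<forall>j\<le>k. \<forall>x\<in>ob (ty_sem \<tau>) j.
        j \<in> sieve_of (tm_sem P (push \<tau> G) j (push x (ctx_res G n j \<gamma>))))}"
| "tm_sem (Ex \<tau> P) G n \<gamma> = sievev {k. k \<le> n \<and>
     (\<exists>x\<in>ob (ty_sem \<tau>) k. k \<in> sieve_of (tm_sem P (push \<tau> G) k (push x (ctx_res G n k \<gamma>))))}"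
| "tm_sem (Lift e) G n \<gamma> =
     sievev (case n of 0 \<Rightarrow> {0} | Suc m \<Rightarrow> {0} \<union> Suc ` sieve_of (tm_sem e G n \<gamma>))"
| "tm_sem Top G n \<gamma> = sievev {..n}"
| "tm_sem Bot G n \<gamma> = sievev {}"
| "tm_sem (Eq \<tau> e e') G n \<gamma> = sievev {k. k \<le> n \<and>
     res (ty_sem \<tau>) n k (tm_sem e G n \<gamma>) = res (ty_sem \<tau>) n k (tm_sem e' G n \<gamma>)}"
| "tm_sem (AxTm \<tau> f) G n \<gamma> = f n"


section \<open>Judgmental equality\<close>

inductive jeq :: "'u::universe ctx \<Rightarrow> 'u tm \<Rightarrow> 'u tm \<Rightarrow> 'u ty \<Rightarrow> bool" where
  j_refl: "typed G e \<tau> \<Longrightarrow> jeq G e e \<tau>"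
| j_sym: "jeq G e e' \<tau> \<Longrightarrow> jeq G e' e \<tau>"
| j_trans: "jeq G e e' \<tau> \<Longrightarrow> jeq G e' e'' \<tau> \<Longrightarrow> jeq G e e'' \<tau>"

\<comment> \<open>congruence\<close>
| c_Odot: "jeq G f f' (TDelta (funset T S)) \<Longrightarrow> jeq G x x' (TDelta T) \<Longrightarrow>
    jeq G (Odot T S f x) (Odot T S f' x') (TDelta S)"
| c_Pure: "jeq G e e' (TDelta Prop_set) \<Longrightarrow> jeq G (Pure e) (Pure e') TOmega"
| c_Lam: "jeq ((\<tau> # \<Gamma>) # G) e e' \<sigma> \<Longrightarrow> jeq (\<Gamma> # G) (Lam \<tau> e) (Lam \<tau> e') (TFun \<tau> \<sigma>)"
| c_App: "jeq G f f' (TFun \<tau> \<sigma>) \<Longrightarrow> jeq G e e' \<tau> \<Longrightarrow> jeq G (App f e) (App f' e') \<sigma>"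
| c_Delay: "G \<noteq> [] \<Longrightarrow> jeq ([] # G) e e' \<tau> \<Longrightarrow> jeq G (Delay e) (Delay e') (TLater \<tau>)"
| c_Adv: "0 < n \<Longrightarrow> n < length G \<Longrightarrow> jeq (drop n G) e e' (TLater \<tau>) \<Longrightarrow>
    jeq G (Adv n e) (Adv n e') \<tau>"
| c_Fix: "jeq ((TLater \<tau> # \<Gamma>) # G) e e' \<tau> \<Longrightarrow> jeq (\<Gamma> # G) (Fix \<tau> e) (Fix \<tau> e') \<tau>"
| c_Pair: "jeq G e e' \<tau> \<Longrightarrow> jeq G f f' \<sigma> \<Longrightarrow> jeq G (Pair e f) (Pair e' f') (TProd \<tau> \<sigma>)"
| c_ProjL: "jeq G e e' (TProd \<tau> \<sigma>) \<Longrightarrow> jeq G (Proj e L) (Proj e' L) \<tau>"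
| c_ProjR: "jeq G e e' (TProd \<tau> \<sigma>) \<Longrightarrow> jeq G (Proj e R) (Proj e' R) \<sigma>"
| c_Inl: "jeq G e e' \<tau> \<Longrightarrow> jeq G (Inl \<sigma> e) (Inl \<sigma> e') (TSum \<tau> \<sigma>)"
| c_Inr: "jeq G e e' \<sigma> \<Longrightarrow> jeq G (Inr \<tau> e) (Inr \<tau> e') (TSum \<tau> \<sigma>)"
| c_Case: "jeq G e e' (TSum \<tau> \<sigma>) \<Longrightarrow> jeq G f f' (TFun \<tau> \<rho>) \<Longrightarrow> jeq G g g' (TFun \<sigma> \<rho>) \<Longrightarrow>
    jeq G (Case e f g) (Case e' f' g') \<rho>"
| c_And: "jeq G P P' TOmega \<Longrightarrow> jeq G Q Q' TOmega \<Longrightarrow> jeq G (And P Q) (And P' Q') TOmega"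
| c_Or: "jeq G P P' TOmega \<Longrightarrow> jeq G Q Q' TOmega \<Longrightarrow> jeq G (Or P Q) (Or P' Q') TOmega"
| c_Imp: "jeq G P P' TOmega \<Longrightarrow> jeq G Q Q' TOmega \<Longrightarrow> jeq G (Imp P Q) (Imp P' Q') TOmega"
| c_All: "jeq ((\<tau> # \<Gamma>) # G) P P' TOmega \<Longrightarrow> jeq (\<Gamma> # G) (All \<tau> P) (All \<tau> P') TOmega"
| c_Ex: "jeq ((\<tau> # \<Gamma>) # G) P P' TOmega \<Longrightarrow> jeq (\<Gamma> # G) (Ex \<tau> P) (Ex \<tau> P') TOmega"
| c_Lift: "jeq G e e' (TLater TOmega) \<Longrightarrow> jeq G (Lift e) (Lift e') TOmega"
| c_Eq: "jeq G e e' \<tau> \<Longrightarrow> jeq G f f' \<tau> \<Longrightarrow> jeq G (Eq \<tau> e f) (Eq \<tau> e' f') TOmega"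

\<comment> \<open>axioms\<close>
| j_beta: "typed ((\<tau> # \<Gamma>) # G) e \<sigma> \<Longrightarrow> typed (\<Gamma> # G) e' \<tau> \<Longrightarrow>
    typed (\<Gamma> # G) (subst e e') \<sigma> \<Longrightarrow> jeq (\<Gamma> # G) (App (Lam \<tau> e) e') (subst e e') \<sigma>"
| j_eta: "typed G e (TFun \<tau> \<sigma>) \<Longrightarrow> typed G (Lam \<tau> (App (up e) (Var 0 0))) (TFun \<tau> \<sigma>) \<Longrightarrow>
    jeq G e (Lam \<tau> (App (up e) (Var 0 0))) (TFun \<tau> \<sigma>)"
| j_ProjL: "typed G e \<tau> \<Longrightarrow> typed G e' \<sigma> \<Longrightarrow> jeq G (Proj (Pair e e') L) e \<tau>"
| j_ProjR: "typed G e \<tau> \<Longrightarrow> typed G e' \<sigma> \<Longrightarrow> jeq G (Proj (Pair e e') R) e' \<sigma>"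
| j_Pair_eta: "typed G e (TProd \<tau> \<sigma>) \<Longrightarrow> jeq G e (Pair (Proj e L) (Proj e R)) (TProd \<tau> \<sigma>)"
| j_Case_Inl: "typed G a \<tau> \<Longrightarrow> typed G f (TFun \<tau> \<rho>) \<Longrightarrow> typed G g (TFun \<sigma> \<rho>) \<Longrightarrow>
    jeq G (Case (Inl \<sigma> a) f g) (App f a) \<rho>"
| j_Case_Inr: "typed G b \<sigma> \<Longrightarrow> typed G f (TFun \<tau> \<rho>) \<Longrightarrow> typed G g (TFun \<sigma> \<rho>) \<Longrightarrow>
    jeq G (Case (Inr \<tau> b) f g) (App g b) \<rho>"
| j_Odot: "G \<noteq> [] \<Longrightarrow> f \<in> elts (funset T S) \<Longrightarrow> x \<in> elts T \<Longrightarrow>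
    jeq G (Odot T S (Dl (funset T S) f) (Dl T x)) (Dl S (applyv f x)) (TDelta S)"
| j_Adv_Delay: "0 < n \<Longrightarrow> n < length G \<Longrightarrow> typed ([] # drop n G) e \<tau> \<Longrightarrow>
    typed G (wk (n - 1) e) \<tau> \<Longrightarrow> jeq G (Adv n (Delay e)) (wk (n - 1) e) \<tau>"
| j_Delay_Adv: "typed G e (TLater \<tau>) \<Longrightarrow> typed G (Delay (Adv 1 e)) (TLater \<tau>) \<Longrightarrow>
    jeq G e (Delay (Adv 1 e)) (TLater \<tau>)"
| j_Fix: "typed G (Fix \<tau> e) \<tau> \<Longrightarrow> typed G (subst e (Delay (wk 1 (Fix \<tau> e)))) \<tau> \<Longrightarrow>
    jeq G (Fix \<tau> e) (subst e (Delay (wk 1 (Fix \<tau> e)))) \<tau>"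
| j_sem: "typed G e \<tau> \<Longrightarrow> typed G e' \<tau> \<Longrightarrow>
    (\<And>n \<gamma>. \<gamma> \<in> ctx_sem G n \<Longrightarrow> tm_sem e G n \<gamma> = tm_sem e' G n \<gamma>) \<Longrightarrow> jeq G e e' \<tau>"


section \<open>Provability\<close>

definition later :: "'u::universe tm \<Rightarrow> 'u tm" where
  "later \<Phi> = Lift (Delay \<Phi>)"

definition wf_seq :: "'u::universe ctx \<Rightarrow> 'u tm list list \<Rightarrow> 'u tm \<Rightarrow> bool" where
  "wf_seq G H \<Phi> \<longleftrightarrow> G \<noteq> [] \<and> length H = length G \<and>
     (\<forall>k<length H. \<forall>\<psi>\<in>set (H ! k). typed (drop k G) \<psi> TOmega) \<and> typed G \<Phi> TOmega"

inductive prov :: "'u::universe ctx \<Rightarrow> 'u tm list list \<Rightarrow> 'u tm \<Rightarrow> bool" where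
  p_asm: "wf_seq G H (wk k \<Phi>) \<Longrightarrow> k < length H \<Longrightarrow> \<Phi> \<in> set (H ! k) \<Longrightarrow> prov G H (wk k \<Phi>)"
| p_TopI: "wf_seq G H Top \<Longrightarrow> prov G H Top"
| p_BotE: "wf_seq G H C \<Longrightarrow> prov G H Bot \<Longrightarrow> prov G H C"
| p_AndI: "prov G H P \<Longrightarrow> prov G H Q \<Longrightarrow> prov G H (And P Q)"
| p_AndE1: "prov G H (And P Q) \<Longrightarrow> prov G H P"
| p_AndE2: "prov G H (And P Q) \<Longrightarrow> prov G H Q"
| p_OrI1: "wf_seq G H (Or P Q) \<Longrightarrow> prov G H P \<Longrightarrow> prov G H (Or P Q)"
| p_OrI2: "wf_seq G H (Or P Q) \<Longrightarrow> prov G H Q \<Longrightarrow> prov G H (Or P Q)"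
| p_OrE: "prov G (\<Psi> # H) (Or P Q) \<Longrightarrow> prov G ((P # \<Psi>) # H) C \<Longrightarrow> prov G ((Q # \<Psi>) # H) C \<Longrightarrow>
    prov G (\<Psi> # H) C"
| p_ImpI: "prov G ((P # \<Psi>) # H) Q \<Longrightarrow> prov G (\<Psi> # H) (Imp P Q)"
| p_ImpE: "prov G H (Imp P Q) \<Longrightarrow> prov G H P \<Longrightarrow> prov G H Q"
| p_AllI: "wf_seq (\<Gamma> # G) (\<Psi> # H) (All \<tau> \<Phi>) \<Longrightarrow>
    prov ((\<tau> # \<Gamma>) # G) (map up \<Psi> # H) \<Phi> \<Longrightarrow> prov (\<Gamma> # G) (\<Psi> # H) (All \<tau> \<Phi>)"
| p_AllE: "wf_seq G H (subst \<Phi> e) \<Longrightarrow> prov G H (All \<tau> \<Phi>) \<Longrightarrow> typed G e \<tau> \<Longrightarrow>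
    prov G H (subst \<Phi> e)"
| p_ExI: "wf_seq G H (Ex \<tau> \<Phi>) \<Longrightarrow> typed G e \<tau> \<Longrightarrow> prov G H (subst \<Phi> e) \<Longrightarrow> prov G H (Ex \<tau> \<Phi>)"
| p_ExE: "wf_seq (\<Gamma> # G) (\<Psi> # H) C \<Longrightarrow> prov (\<Gamma> # G) (\<Psi> # H) (Ex \<tau> \<Phi>) \<Longrightarrow>
    prov ((\<tau> # \<Gamma>) # G) ((\<Phi> # map up \<Psi>) # H) (up C) \<Longrightarrow> prov (\<Gamma> # G) (\<Psi> # H) C"
| p_DeltaI: "wf_seq G H (All (TDelta T) \<Phi>) \<Longrightarrow>
    (\<And>a. a \<in> elts T \<Longrightarrow> prov G H (subst \<Phi> (Dl T a))) \<Longrightarrow> prov G H (All (TDelta T) \<Phi>)"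
| p_SumE: "wf_seq (\<Gamma> # G) (\<Psi> # H) C \<Longrightarrow> typed (\<Gamma> # G) e (TSum \<tau> \<sigma>) \<Longrightarrow>
    prov ((\<tau> # \<Gamma>) # G) ((Eq (TSum \<tau> \<sigma>) (up e) (Inl \<sigma> (Var 0 0)) # map up \<Psi>) # H) (up C) \<Longrightarrow>
    prov ((\<sigma> # \<Gamma>) # G) ((Eq (TSum \<tau> \<sigma>) (up e) (Inr \<tau> (Var 0 0)) # map up \<Psi>) # H) (up C) \<Longrightarrow>
    prov (\<Gamma> # G) (\<Psi> # H) C"
| p_LaterI: "wf_seq G H (later \<Phi>) \<Longrightarrow> prov ([] # G) ([] # H) \<Phi> \<Longrightarrow> prov G H (later \<Phi>)"
| p_LaterMono: "prov G H (later P) \<Longrightarrow> prov ([] # G) ([P] # H) Q \<Longrightarrow> prov G H (later Q)"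
| p_LaterAnd: "prov G H (later P) \<Longrightarrow> prov G H (later Q) \<Longrightarrow> prov G H (later (And P Q))"
| p_LaterOr: "prov G H (later (Or P Q)) \<Longrightarrow> prov G H (Or (later P) (later Q))"
| p_Loeb: "wf_seq G (\<Psi> # H) \<Phi> \<Longrightarrow> prov G ((later (wk 1 \<Phi>) # \<Psi>) # H) \<Phi> \<Longrightarrow> prov G (\<Psi> # H) \<Phi>"
| p_LaterEq: "prov G H (later (Eq \<tau> e1 e2)) \<Longrightarrow> prov G H (Eq (TLater \<tau>) (Delay e1) (Delay e2))"
| p_jeq: "wf_seq G H (Eq \<tau> e1 e2) \<Longrightarrow> jeq G e1 e2 \<tau> \<Longrightarrow> prov G H (Eq \<tau> e1 e2)"
| p_subst: "wf_seq (\<Gamma> # G) H (subst \<Phi> e2) \<Longrightarrow> typed ((\<tau> # \<Gamma>) # G) \<Phi> TOmega \<Longrightarrow>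
    prov (\<Gamma> # G) H (Eq \<tau> e1 e2) \<Longrightarrow> prov (\<Gamma> # G) H (subst \<Phi> e1) \<Longrightarrow> prov (\<Gamma> # G) H (subst \<Phi> e2)"
| p_Pure: "wf_seq G H (Pure (Dl Prop_set (truthv P))) \<Longrightarrow> P \<Longrightarrow>
    prov G H (Pure (Dl Prop_set (truthv P)))"
| p_InlInj: "prov G H (Eq (TSum \<tau> \<sigma>) (Inl \<sigma> a) (Inl \<sigma> b)) \<Longrightarrow> prov G H (Eq \<tau> a b)"
| p_InrInj: "prov G H (Eq (TSum \<tau> \<sigma>) (Inr \<tau> a) (Inr \<tau> b)) \<Longrightarrow> prov G H (Eq \<sigma> a b)"
| p_InlInr: "prov G H (Eq (TSum \<tau> \<sigma>) (Inl \<sigma> a) (Inr \<tau> b)) \<Longrightarrow> prov G H Bot"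

definition provable :: "'u::universe tm \<Rightarrow> bool" where
  "provable \<Phi> \<longleftrightarrow> prov [[]] [[]] \<Phi>"


section \<open>The object language\<close>

datatype lam = LUnit | LVar nat | LApp lam lam | LLam lam | LFix lam

primrec in_Lambda :: "nat \<Rightarrow> lam \<Rightarrow> bool" where
  "in_Lambda n LUnit = True"
| "in_Lambda n (LVar i) = (i < n)"
| "in_Lambda n (LApp t u) = (in_Lambda n t \<and> in_Lambda n u)"
| "in_Lambda n (LLam t) = in_Lambda (Suc n) t"
| "in_Lambda n (LFix t) = in_Lambda (Suc n) t"

definition Lambda :: "nat \<Rightarrow> lam set" where
  "Lambda n = {t. in_Lambda n t}"

primrec llift :: "nat \<Rightarrow> lam \<Rightarrow> lam" where
  "llift c LUnit = LUnit"
| "llift c (LVar i) = LVar (if i < c then i else Suc i)"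
| "llift c (LApp t u) = LApp (llift c t) (llift c u)"
| "llift c (LLam t) = LLam (llift (Suc c) t)"
| "llift c (LFix t) = LFix (llift (Suc c) t)"

primrec lsubst_at :: "nat \<Rightarrow> lam \<Rightarrow> lam \<Rightarrow> lam" where
  "lsubst_at c u LUnit = LUnit"
| "lsubst_at c u (LVar i) = (if i < c then LVar i else if i = c then u else LVar (i - 1))"
| "lsubst_at c u (LApp t t') = LApp (lsubst_at c u t) (lsubst_at c u t')"
| "lsubst_at c u (LLam t) = LLam (lsubst_at (Suc c) (llift 0 u) t)"
| "lsubst_at c u (LFix t) = LFix (lsubst_at (Suc c) (llift 0 u) t)"

definition lsubst :: "lam \<Rightarrow> lam \<Rightarrow> lam" where
  "lsubst t u = lsubst_at 0 u t"

inductive step :: "lam \<Rightarrow> lam \<Rightarrow> bool" where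
  step_beta: "step (LApp (LLam t) u) (lsubst t u)"
| step_app: "step t t' \<Longrightarrow> step (LApp t u) (LApp t' u)"
| step_fix: "step (LFix t) (lsubst t (LFix t))"


section \<open>The semantic domain\<close>

definition Dom :: "'u::universe obj \<Rightarrow> 'u ty" where
  "Dom D = TAx D"

definition rest2 :: "'u::universe obj \<Rightarrow> 'u ty" where
  "rest2 D = TSum (TLater (Dom D)) (TLater (TFun (Dom D) (Dom D)))"

definition rest1 :: "'u::universe obj \<Rightarrow> 'u ty" where
  "rest1 D = TSum (TDelta unit_set) (rest2 D)"

definition Dom_sum :: "'u::universe obj \<Rightarrow> 'u ty" where
  "Dom_sum D = TSum (TDelta nat_set) (rest1 D)"

definition is_domain :: "'u::universe obj \<Rightarrow> (nat \<Rightarrow> 'u \<Rightarrow> 'u) \<Rightarrow> bool" where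
  "is_domain D \<theta> \<longleftrightarrow> obj_iso (ty_sem (Dom_sum D)) D \<theta>"

text \<open>Domains exist: \<open>Dom_sum\<close> is contractive, so its iterates converge to a fixed point.\<close>

definition agree :: "nat \<Rightarrow> 'u::universe obj \<Rightarrow> 'u obj \<Rightarrow> bool" where
  "agree n X Y \<longleftrightarrow>
     (\<forall>k<n. ob X k = ob Y k \<and> (\<forall>j\<le>k. \<forall>x\<in>ob X k. res X k j x = res Y k j x))"

lemma agree_sum:
  assumes "agree n X X'" "agree n Y Y'" shows "agree n (sum_obj X Y) (sum_obj X' Y')"
  using assms unfolding agree_def
  by (auto simp del: res_sum_inl res_sum_inr)
    (metis res_sum_inl res_sum_inr)+

lemma agree_exp:
  assumes X: "agree n X X'" and Y: "agree n Y Y'" shows "agree n (exp_obj X Y) (exp_obj X' Y')"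
proof -
  have fam: "famv X k \<phi> = famv X' k \<phi>" if "k < n" for k \<phi>
  proof -
    have "{pair (pair (natv j) x) (\<phi> j x) | j x. j \<le> k \<and> x \<in> ob X j} =
        {pair (pair (natv j) x) (\<phi> j x) | j x. j \<le> k \<and> x \<in> ob X' j}"
      using X that by (auto simp: agree_def)
    then show ?thesis by (simp add: famv_def)
  qed
  have nat: "natural_upto X Y k \<phi> \<longleftrightarrow> natural_upto X' Y' k \<phi>" if "k < n" for k \<phi>
    unfolding natural_upto_def
  proof (intro conj_cong all_cong1 imp_cong refl)
    show "(\<forall>x\<in>ob X j. \<phi> j x \<in> ob Y j) \<longleftrightarrow> (\<forall>x\<in>ob X' j. \<phi> j x \<in> ob Y' j)" if "j \<le> k" for j
      using X Y that \<open>k < n\<close> by (simp add: agree_def)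
  next
    fix i j assume *: "\<forall>j\<le>k. \<forall>x\<in>ob X' j. \<phi> j x \<in> ob Y' j" "i \<le> k" "j \<le> i"
    have "i < n" using * that by simp
    then show "(\<forall>x\<in>ob X i. \<phi> j (res X i j x) = res Y i j (\<phi> i x)) \<longleftrightarrow>
        (\<forall>x\<in>ob X' i. \<phi> j (res X' i j x) = res Y' i j (\<phi> i x))"
      using X Y * by (auto simp: agree_def)
  qed
  show ?thesis
    unfolding agree_def
  proof (intro allI impI conjI ballI)
    fix k assume k: "k < n"
    show eq: "ob (exp_obj X Y) k = ob (exp_obj X' Y') k"
      using fam[OF k] nat[OF k] by simp
    fix j g assume "j \<le> k" "g \<in> ob (exp_obj X Y) k"
    then show "res (exp_obj X Y) k j g = res (exp_obj X' Y') k j g"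
      using fam[of j] k eq by (simp add: res_exp del: ob_exp)
  qed
qed

lemma agree_later: "agree n X Y \<Longrightarrow> agree (Suc n) (later_obj X) (later_obj Y)"
  unfolding agree_def
proof (intro allI impI)
  fix k
  assume *: "\<forall>k<n. ob X k = ob Y k \<and> (\<forall>j\<le>k. \<forall>x\<in>ob X k. res X k j x = res Y k j x)"
    and k: "k < Suc n"
  have eq: "ob (later_obj X) k = ob (later_obj Y) k"
    using * k by (cases k) auto
  have "res (later_obj X) k j x = res (later_obj Y) k j x"
    if jx: "j \<le> k" "x \<in> ob (later_obj X) k" for j x
  proof (cases j)
    case 0
    then show ?thesis using jx eq by simp
  next
    case (Suc i)
    then obtain m where "k = Suc m" using jx by (cases k) auto
    then show ?thesis using Suc jx * k by simp
  qed
  with eq show "ob (later_obj X) k = ob (later_obj Y) k \<and> (\<forall>j\<le>k. \<forall>x\<in>ob (later_obj X) k.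
      res (later_obj X) k j x = res (later_obj Y) k j x)" by blast
qed

lemma agree_Dom_sum:
  "agree n X Y \<Longrightarrow> agree (Suc n) (ty_sem (Dom_sum X)) (ty_sem (Dom_sum Y))"
  unfolding Dom_sum_def rest1_def rest2_def Dom_def ty_sem.simps
  by (intro agree_sum agree_later agree_exp) (simp_all add: agree_def)

lemma domain_exists: "\<exists>(D :: 'u::universe obj) \<theta>. is_domain D \<theta>"
proof -
  define F where "F X = ty_sem (Dom_sum X)" for X :: "'u obj"
  define A where "A i = (F ^^ i) (const_obj unit_set)" for i
  have A: "agree i (A i) (A j)" if "i \<le> j" for i j
    using that
  proof (induction i arbitrary: j)
    case 0
    then show ?case by (simp add: agree_def)
  next
    case (Suc i)
    then obtain j' where "j = Suc j'" "i \<le> j'" by (cases j) auto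
    then show ?case using agree_Dom_sum[OF Suc.IH] by (simp add: A_def F_def)
  qed
  define X where "X n = ob (A (Suc n)) n" for n
  define r where "r n = res (A (Suc n)) n" for n
  have obA: "ob (A (Suc n)) k = X k" if "k \<le> n" for n k
    using A[of "Suc k" "Suc n"] that by (simp add: agree_def X_def)
  have resA: "res (A (Suc n)) k j x = r k j x" if "j \<le> k" "k \<le> n" "x \<in> X k" for n k j x
    using A[of "Suc k" "Suc n"] that by (simp add: agree_def X_def r_def)
  have f: "functorial X r"
    unfolding functorial_def
  proof (intro conjI allI impI)
    show "small (X n)" for n by (simp add: X_def)
    show in_X: "r n k x \<in> X k" if "k \<le> n" "x \<in> X n" for n k x
      using that res_in[of k n x "A (Suc n)"] by (simp add: obA r_def)
    show "r n n x = x" if "x \<in> X n" for n x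
      using that by (simp add: X_def r_def)
    show "r m k (r n m x) = r n k x" if "k \<le> m" "m \<le> n" "x \<in> X n" for n m k x
      using that res_res[of k m n x "A (Suc n)"] by (simp add: obA resA in_X)
  qed
  define D where "D = mk_obj X r"
  have D: "agree n D (A n)" for n
    unfolding agree_def
  proof (intro allI impI conjI ballI)
    fix k assume "k < n"
    then obtain m where m: "n = Suc m" "k \<le> m" by (cases n) auto
    show "ob D k = ob (A n) k"
      using m by (simp add: D_def ob_mk_obj[OF f] obA)
    fix j x assume "j \<le> k" "x \<in> ob D k"
    then show "res D k j x = res (A n) k j x"
      using m by (simp add: D_def ob_mk_obj[OF f] res_mk_obj[OF f] resA)
  qed
  have FD: "agree (Suc n) (ty_sem (Dom_sum D)) (A (Suc n))" for n
    using agree_Dom_sum[OF D[of n]] by (simp add: A_def F_def)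
  have ob_eq: "ob (ty_sem (Dom_sum D)) n = ob D n" for n
    using FD[of n] D[of "Suc n"] by (simp add: agree_def)
  have res_eq: "res (ty_sem (Dom_sum D)) n k x = res D n k x" if "k \<le> n" "x \<in> ob D n" for n k x
    using FD[of n] D[of "Suc n"] that ob_eq[of n] by (simp add: agree_def del: ty_sem.simps)
  have "is_domain D (\<lambda>n x. x)"
    by (simp add: is_domain_def obj_iso_def ob_eq res_eq bij_betw_def)
  then show ?thesis by blast
qed

text \<open>The global element of the exponential \<open>Y\<^sup>X\<close> that names a morphism \<open>\<phi> : X \<rightarrow> Y\<close>.\<close>

definition name_of :: "'u::universe obj \<Rightarrow> (nat \<Rightarrow> 'u \<Rightarrow> 'u) \<Rightarrow> nat \<Rightarrow> 'u" where
  "name_of X \<phi> n = famv X n \<phi>"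

definition MK :: "'u::universe obj \<Rightarrow> (nat \<Rightarrow> 'u \<Rightarrow> 'u) \<Rightarrow> 'u tm" where
  "MK D \<theta> = AxTm (TFun (Dom_sum D) (Dom D)) (name_of (ty_sem (Dom_sum D)) \<theta>)"

definition PROJ :: "'u::universe obj \<Rightarrow> (nat \<Rightarrow> 'u \<Rightarrow> 'u) \<Rightarrow> 'u tm" where
  "PROJ D \<theta> = AxTm (TFun (Dom D) (Dom_sum D))
     (name_of D (\<lambda>n. the_inv_into (ob (ty_sem (Dom_sum D)) n) (\<theta> n)))"

definition num_tm :: "'u::universe obj \<Rightarrow> (nat \<Rightarrow> 'u \<Rightarrow> 'u) \<Rightarrow> 'u tm" where
  "num_tm D \<theta> = Lam (TDelta nat_set) (App (MK D \<theta>) (Inl (rest1 D) (Var 0 0)))"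

definition error_tm :: "'u::universe obj \<Rightarrow> (nat \<Rightarrow> 'u \<Rightarrow> 'u) \<Rightarrow> 'u tm" where
  "error_tm D \<theta> = Lam (TDelta unit_set)
     (App (MK D \<theta>) (Inr (TDelta nat_set) (Inl (rest2 D) (Var 0 0))))"

definition thunk_tm :: "'u::universe obj \<Rightarrow> (nat \<Rightarrow> 'u \<Rightarrow> 'u) \<Rightarrow> 'u tm" where
  "thunk_tm D \<theta> = Lam (TLater (Dom D))
     (App (MK D \<theta>) (Inr (TDelta nat_set) (Inr (TDelta unit_set)
        (Inl (TLater (TFun (Dom D) (Dom D))) (Var 0 0)))))"

definition lam_tm :: "'u::universe obj \<Rightarrow> (nat \<Rightarrow> 'u \<Rightarrow> 'u) \<Rightarrow> 'u tm" where
  "lam_tm D \<theta> = Lam (TLater (TFun (Dom D) (Dom D)))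
     (App (MK D \<theta>) (Inr (TDelta nat_set) (Inr (TDelta unit_set)
        (Inr (TLater (Dom D)) (Var 0 0)))))"

text \<open>In the body of \<open>apply_tm\<close>, before the case analysis, \<open>\<mu> = Var 0 2\<close>, \<open>d = Var 0 1\<close> and
  \<open>x = Var 0 0\<close>. Each level of the case analysis adds one binder, so in the last two branches
  \<open>w\<close> (resp. \<open>g\<close>) is \<open>Var 0 0\<close>, \<open>x\<close> is \<open>Var 0 3\<close> (\<open>Var 1 3\<close> under \<open>Delay\<close>) and \<open>\<mu>\<close> is
  \<open>Var 0 5\<close>.\<close>

definition apply_tm :: "'u::universe obj \<Rightarrow> (nat \<Rightarrow> 'u \<Rightarrow> 'u) \<Rightarrow> 'u tm" where
  "apply_tm D \<theta> =
     Fix (TFun (Dom D) (TFun (Dom D) (Dom D))) (Lam (Dom D) (Lam (Dom D)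
       (Case (App (PROJ D \<theta>) (Var 0 1))
         (Lam (TDelta nat_set) (App (error_tm D \<theta>) (Dl unit_set star)))
         (Lam (rest1 D) (Case (Var 0 0)
           (Lam (TDelta unit_set) (App (error_tm D \<theta>) (Dl unit_set star)))
           (Lam (rest2 D) (Case (Var 0 0)
             (Lam (TLater (Dom D)) (App (thunk_tm D \<theta>)
               (Delay (App (App (Adv 1 (Var 0 5)) (Adv 1 (Var 0 0))) (Var 1 3)))))
             (Lam (TLater (TFun (Dom D) (Dom D))) (App (thunk_tm D \<theta>)
               (Delay (App (Adv 1 (Var 0 0)) (Var 1 3))))))))))))"

primrec Env :: "'u::universe obj \<Rightarrow> nat \<Rightarrow> 'u ty" where
  "Env D 0 = TDelta unit_set"
| "Env D (Suc n) = TProd (Env D n) (Dom D)"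

primrec lookup :: "'u::universe tm \<Rightarrow> nat \<Rightarrow> 'u tm" where
  "lookup r 0 = Proj r R"
| "lookup r (Suc i) = lookup (Proj r L) i"

text \<open>\<open>interp D \<theta> e n\<close> is only meaningful for \<open>e \<in> Lambda n\<close>.\<close>

primrec interp :: "'u::universe obj \<Rightarrow> (nat \<Rightarrow> 'u \<Rightarrow> 'u) \<Rightarrow> lam \<Rightarrow> nat \<Rightarrow> 'u tm" where
  "interp D \<theta> LUnit n = Lam (Env D n) (App (num_tm D \<theta>) (Dl nat_set (natv 0)))"
| "interp D \<theta> (LVar i) n = Lam (Env D n) (lookup (Var 0 0) i)"
| "interp D \<theta> (LApp t u) n = Lam (Env D n)
     (App (App (apply_tm D \<theta>) (App (interp D \<theta> t n) (Var 0 0))) (App (interp D \<theta> u n) (Var 0 0)))"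
| "interp D \<theta> (LLam t) n = Lam (Env D n) (App (lam_tm D \<theta>)
     (Delay (Lam (Dom D) (App (interp D \<theta> t (Suc n)) (Pair (Var 1 0) (Var 0 0))))))"
| "interp D \<theta> (LFix t) n = Lam (Env D n) (Fix (Dom D) (App (thunk_tm D \<theta>)
     (Delay (App (interp D \<theta> t (Suc n)) (Pair (Var 1 1) (Adv 1 (Var 0 0)))))))"

end

theory Submission
  imports Defs
begin

text \<open>
  Judgmental equality contains every semantic identity between well-typed terms, so it suffices to
  show that the two sides of the equation denote the same morphism. Each object-language term
  denotes a natural family of functions \<open>Env n \<rightarrow> Dom\<close>, for which weakening and substitution
  become insertion of a value into the environment. Both \<open>fix\<close> and \<open>apply\<close>, the latter on
  closures and thunks, return a thunk whose content lives one stage earlier. This is why a single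
  reduction step of the object language shows up semantically as exactly one \<open>thunk \<circ> delay\<close>.
\<close>

lemma typed_Var: "p < length G \<Longrightarrow> q < length (G ! p) \<Longrightarrow> G ! p ! q = \<tau> \<Longrightarrow> typed G (Var p q) \<tau>"
  using t_Var by blast

lemma evalv_in: "g \<in> ob (exp_obj X Y) n \<Longrightarrow> x \<in> ob X n \<Longrightarrow> evalv g n x \<in> ob Y n"
  by (auto simp: natural_upto_def)

lemma evalv_res: "g \<in> ob (exp_obj X Y) n \<Longrightarrow> x \<in> ob X n \<Longrightarrow> k \<le> n \<Longrightarrow>
    evalv (res (exp_obj X Y) n k g) k (res X n k x) = res Y n k (evalv g n x)"
  by (auto simp: natural_upto_def)

section \<open>The isomorphism \<open>\<theta>\<close> and the constructors of the domain\<close>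

locale semantic_domain =
  fixes D :: "'u::universe obj" and \<theta> :: "nat \<Rightarrow> 'u \<Rightarrow> 'u"
  assumes domain: "is_domain D \<theta>"
begin

abbreviation S :: "'u obj" where "S \<equiv> ty_sem (Dom_sum D)"
abbreviation E :: "nat \<Rightarrow> 'u obj" where "E n \<equiv> ty_sem (Env D n)"

definition unroll :: "nat \<Rightarrow> 'u \<Rightarrow> 'u" where
  "unroll n = the_inv_into (ob S n) (\<theta> n)"

lemma roll_bij: "bij_betw (\<theta> n) (ob S n) (ob D n)"
  using domain by (simp add: is_domain_def obj_iso_def)

lemma roll_in: "s \<in> ob S n \<Longrightarrow> \<theta> n s \<in> ob D n"
  using roll_bij bij_betwE by blast

lemma roll_res: "k \<le> n \<Longrightarrow> s \<in> ob S n \<Longrightarrow> res D n k (\<theta> n s) = \<theta> k (res S n k s)"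
  using domain by (simp add: is_domain_def obj_iso_def)

lemma unroll_roll: "s \<in> ob S n \<Longrightarrow> unroll n (\<theta> n s) = s"
  unfolding unroll_def using roll_bij by (simp add: bij_betw_def the_inv_into_f_f)

lemma unroll_in: "d \<in> ob D n \<Longrightarrow> unroll n d \<in> ob S n"
  unfolding unroll_def
  using roll_bij[of n] by (metis bij_betwE bij_betw_the_inv_into)

lemma roll_unroll: "d \<in> ob D n \<Longrightarrow> \<theta> n (unroll n d) = d"
  unfolding unroll_def using roll_bij[of n] by (metis bij_betw_def f_the_inv_into_f)

text \<open>\<open>obj_iso\<close> asks for naturality of \<open>\<theta>\<close> only; the inverse
  inherits it because every element of the domain is a value of \<open>\<theta>\<close>.\<close>

lemma unroll_res:
  assumes "k \<le> n" "d \<in> ob D n" shows "unroll k (res D n k d) = res S n k (unroll n d)"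
proof -
  have "res D n k d = \<theta> k (res S n k (unroll n d))"
    using roll_res[OF assms(1) unroll_in[OF assms(2)]] by (simp add: roll_unroll assms(2))
  then show ?thesis using assms by (simp add: unroll_roll unroll_in)
qed

lemma S_eq: "S = sum_obj (const_obj nat_set) (sum_obj (const_obj unit_set)
    (sum_obj (later_obj D) (later_obj (exp_obj D D))))"
  by (simp add: Dom_sum_def rest1_def rest2_def Dom_def)

text \<open>Stagewise values of \<open>num_tm\<close>, \<open>error_tm\<close>,
  \<open>thunk_tm\<close> and \<open>lam_tm\<close>. The argument of \<open>thunk\<close> or
  \<open>closure\<close> at stage \<open>Suc n\<close> is an element of stage \<open>n\<close>, and
  at stage 0 it is \<open>star\<close>.\<close>

definition num :: "nat \<Rightarrow> 'u \<Rightarrow> 'u" where "num n x = \<theta> n (inlv x)"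
definition err :: "nat \<Rightarrow> 'u" where "err n = \<theta> n (inrv (inlv star))"
definition thunk :: "nat \<Rightarrow> 'u \<Rightarrow> 'u" where "thunk n w = \<theta> n (inrv (inrv (inlv w)))"
definition closure :: "nat \<Rightarrow> 'u \<Rightarrow> 'u" where "closure n g = \<theta> n (inrv (inrv (inrv g)))"

lemma constructors_in:
  "i \<in> elts nat_set \<Longrightarrow> num n i \<in> ob D n"
  "err n \<in> ob D n"
  "w \<in> ob (later_obj D) n \<Longrightarrow> thunk n w \<in> ob D n"
  "g \<in> ob (later_obj (exp_obj D D)) n \<Longrightarrow> closure n g \<in> ob D n"
  unfolding num_def err_def thunk_def closure_def
  by (auto intro!: roll_in simp: S_eq simp del: ob_later ob_exp)

lemma constructors_res:
  assumes "k \<le> n"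
  shows "i \<in> elts nat_set \<Longrightarrow> res D n k (num n i) = num k i"
    and "res D n k (err n) = err k"
    and "w \<in> ob (later_obj D) n \<Longrightarrow> res D n k (thunk n w) = thunk k (res (later_obj D) n k w)"
    and "g \<in> ob (later_obj (exp_obj D D)) n \<Longrightarrow>
      res D n k (closure n g) = closure k (res (later_obj (exp_obj D D)) n k g)"
  unfolding num_def err_def thunk_def closure_def
  using assms by (simp_all add: roll_res S_eq del: ob_later ob_exp)

lemma unroll_constructors:
  "i \<in> elts nat_set \<Longrightarrow> unroll n (num n i) = inlv i"
  "unroll n (err n) = inrv (inlv star)"
  "w \<in> ob (later_obj D) n \<Longrightarrow> unroll n (thunk n w) = inrv (inrv (inlv w))"
  "g \<in> ob (later_obj (exp_obj D D)) n \<Longrightarrow> unroll n (closure n g) = inrv (inrv (inrv g))"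
  unfolding num_def err_def thunk_def closure_def
  by (simp_all add: unroll_roll S_eq del: ob_later ob_exp)

lemma dom_cases [consumes 1, case_names num err thunk closure]:
  assumes "d \<in> ob D n"
  obtains i where "i \<in> elts nat_set" "d = num n i"
  | "d = err n"
  | w where "w \<in> ob (later_obj D) n" "d = thunk n w"
  | g where "g \<in> ob (later_obj (exp_obj D D)) n" "d = closure n g"
  using unroll_in[OF assms] roll_unroll[OF assms] that
  unfolding num_def err_def thunk_def closure_def S_eq ob_sum ob_const elts_unit_set
  by (elim UnE imageE) auto

subsection \<open>Application in the domain\<close>

text \<open>The case distinction of \<open>apply_tm\<close> with the contents of the resulting thunk
  left open, so that stage 0, where they are \<open>star\<close>, shares its facts with the later
  stages.\<close>

definition ap_step :: "nat \<Rightarrow> ('u \<Rightarrow> 'u) \<Rightarrow> ('u \<Rightarrow> 'u) \<Rightarrow> 'u \<Rightarrow> 'u" where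
  "ap_step n v v' d = case_sumv (\<lambda>_. err n) (case_sumv (\<lambda>_. err n)
     (case_sumv (\<lambda>w. thunk n (v w)) (\<lambda>g. thunk n (v' g)))) (unroll n d)"

text \<open>Guarded recursion becomes primitive recursion on the stage: the recursive call sits
  under a thunk, hence one stage earlier.\<close>

primrec ap :: "nat \<Rightarrow> 'u \<Rightarrow> 'u \<Rightarrow> 'u" where
  "ap 0 d x = ap_step 0 (\<lambda>_. star) (\<lambda>_. star) d"
| "ap (Suc n) d x = ap_step (Suc n) (\<lambda>w. ap n w (res D (Suc n) n x))
     (\<lambda>g. evalv g n (res D (Suc n) n x)) d"

lemma ap_step_constructors:
  "i \<in> elts nat_set \<Longrightarrow> ap_step n v v' (num n i) = err n"
  "ap_step n v v' (err n) = err n"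
  "w \<in> ob (later_obj D) n \<Longrightarrow> ap_step n v v' (thunk n w) = thunk n (v w)"
  "g \<in> ob (later_obj (exp_obj D D)) n \<Longrightarrow> ap_step n v v' (closure n g) = thunk n (v' g)"
  by (simp_all add: ap_step_def unroll_constructors del: ob_later ob_exp)

lemma ap_in:
  "d \<in> ob D n \<Longrightarrow> x \<in> ob D n \<Longrightarrow> ap n d x \<in> ob D n"
proof (induction n arbitrary: d x)
  case 0
  from 0(1) show ?case
    by (cases rule: dom_cases) (simp_all add: ap_step_constructors constructors_in)
next
  case (Suc n)
  have x: "res D (Suc n) n x \<in> ob D n" using Suc.prems by simp
  from Suc.prems(1) show ?case
  proof (cases rule: dom_cases)
    case (thunk w)
    then show ?thesis using Suc.IH[OF _ x] by (simp add: ap_step_constructors constructors_in)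
  next
    case (closure g)
    then show ?thesis using evalv_in[of g D D n, OF _ x]
      by (simp add: ap_step_constructors constructors_in del: ob_exp)
  qed (simp_all add: ap_step_constructors constructors_in)
qed

text \<open>Restricting a thunk from \<open>Suc n\<close> to \<open>Suc j\<close> restricts its
  contents from \<open>n\<close> to \<open>j\<close>. There the induction hypothesis serves thunks,
  and naturality of exponential elements serves closures.\<close>

lemma ap_res:
  "k \<le> n \<Longrightarrow> d \<in> ob D n \<Longrightarrow> x \<in> ob D n \<Longrightarrow>
    res D n k (ap n d x) = ap k (res D n k d) (res D n k x)"
proof (induction n arbitrary: k d x)
  case 0
  then show ?case by (simp add: ap_in del: ap.simps)
next
  case (Suc n)
  have x: "res D (Suc n) n x \<in> ob D n" using Suc.prems by simp
  from Suc.prems(2) show ?case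
  proof (cases rule: dom_cases)
    case (num i)
    then show ?thesis using Suc.prems(1)
      by (cases k) (simp_all add: ap_step_constructors constructors_res)
  next
    case err
    then show ?thesis using Suc.prems(1)
      by (cases k) (simp_all add: ap_step_constructors constructors_res)
  next
    case (thunk w)
    then have w: "w \<in> ob D n" by simp
    show ?thesis
    proof (cases k)
      case 0
      then show ?thesis using thunk ap_in[OF w x]
        by (simp add: ap_step_constructors constructors_res)
    next
      case (Suc j)
      then show ?thesis
        using thunk ap_in[OF w x] Suc.IH[OF _ w x, of j] Suc.prems x w
        by (simp add: ap_step_constructors constructors_res)
    qed
  next
    case (closure g)
    then have g: "g \<in> ob (exp_obj D D) n" by (simp del: ob_exp)
    show ?thesis
    proof (cases k)
      case 0
      then show ?thesis using closure evalv_in[OF g x]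
        by (simp add: ap_step_constructors constructors_res del: ob_exp)
    next
      case (Suc j)
      then show ?thesis
        using closure evalv_in[OF g x] evalv_res[OF g x, of j] Suc.prems x g
        by (simp add: ap_step_constructors constructors_res del: ob_exp)
    qed
  qed
qed

subsection \<open>Denotations of object-language terms\<close>

primrec lookupv :: "nat \<Rightarrow> 'u \<Rightarrow> 'u" where
  "lookupv 0 \<rho> = sndv \<rho>"
| "lookupv (Suc i) \<rho> = lookupv i (fstv \<rho>)"

text \<open>The value of \<open>fix y. thunk (delay (F (\<rho>, adv y)))\<close>: at stage
  \<open>Suc k\<close> the variable \<open>y\<close> holds the value of stage
  \<open>k\<close>.\<close>

primrec fixv :: "nat \<Rightarrow> (nat \<Rightarrow> 'u \<Rightarrow> 'u) \<Rightarrow> nat \<Rightarrow> 'u \<Rightarrow> 'u" where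
  "fixv n F 0 \<rho> = thunk 0 star"
| "fixv n F (Suc k) \<rho> = thunk (Suc k)
     (F k (pair (res (E n) (Suc k) k \<rho>) (fixv n F k (res (E n) (Suc k) k \<rho>))))"

text \<open>\<open>den e n k \<rho>\<close> is the value at stage \<open>k\<close> of the morphism \<open>Env n \<rightarrow> Dom\<close> denoted by
  \<open>interp n e\<close>.\<close>

primrec den :: "lam \<Rightarrow> nat \<Rightarrow> nat \<Rightarrow> 'u \<Rightarrow> 'u" where
  "den LUnit n k \<rho> = num k (natv 0)"
| "den (LVar i) n k \<rho> = lookupv i \<rho>"
| "den (LApp t u) n k \<rho> = ap k (den t n k \<rho>) (den u n k \<rho>)"
| "den (LLam t) n k \<rho> = closure k (case k of 0 \<Rightarrow> star | Suc m \<Rightarrow>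
     famv D m (\<lambda>j v. den t (Suc n) j (pair (res (E n) k j \<rho>) v)))"
| "den (LFix t) n k \<rho> = fixv n (den t (Suc n)) k \<rho>"

lemma ob_E_Suc: "ob (E (Suc n)) k = {pair \<rho> v | \<rho> v. \<rho> \<in> ob (E n) k \<and> v \<in> ob D k}"
  by (simp add: Dom_def)

lemma res_E_Suc: "j \<le> k \<Longrightarrow> \<rho> \<in> ob (E n) k \<Longrightarrow> v \<in> ob D k \<Longrightarrow>
    res (E (Suc n)) k j (pair \<rho> v) = pair (res (E n) k j \<rho>) (res D k j v)"
  by (simp add: Dom_def)

lemma lookupv_in: "i < n \<Longrightarrow> \<rho> \<in> ob (E n) k \<Longrightarrow> lookupv i \<rho> \<in> ob D k"
proof (induction i arbitrary: n \<rho>)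
  case 0
  then show ?case by (cases n) (auto simp: Dom_def)
next
  case (Suc i)
  then show ?case by (cases n) (auto simp: Dom_def)
qed

lemma lookupv_res: "i < n \<Longrightarrow> j \<le> k \<Longrightarrow> \<rho> \<in> ob (E n) k \<Longrightarrow>
    res D k j (lookupv i \<rho>) = lookupv i (res (E n) k j \<rho>)"
proof (induction i arbitrary: n \<rho>)
  case 0
  then show ?case by (cases n) (auto simp: Dom_def)
next
  case (Suc i)
  then show ?case by (cases n) (auto simp: Dom_def)
qed

text \<open>Both facts go through one induction: \<open>F\<close> is controlled only where the
  earlier value lies in the domain, and moving a restriction through \<open>F\<close> leaves a
  restriction of that earlier value.\<close>

lemma fixv_natural:
  assumes F: "\<And>k \<rho>. \<rho> \<in> ob (E (Suc n)) k \<Longrightarrow> F k \<rho> \<in> ob D k"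
    "\<And>k j \<rho>. \<rho> \<in> ob (E (Suc n)) k \<Longrightarrow> j \<le> k \<Longrightarrow> res D k j (F k \<rho>) = F j (res (E (Suc n)) k j \<rho>)"
  shows "\<rho> \<in> ob (E n) k \<Longrightarrow> fixv n F k \<rho> \<in> ob D k \<and>
    (\<forall>j\<le>k. res D k j (fixv n F k \<rho>) = fixv n F j (res (E n) k j \<rho>))"
proof (induction k arbitrary: \<rho>)
  case 0
  then show ?case by (simp add: constructors_in constructors_res)
next
  case (Suc k)
  let ?\<rho> = "res (E n) (Suc k) k \<rho>"
  have \<rho>: "?\<rho> \<in> ob (E n) k" using Suc.prems by simp
  note IH = Suc.IH[OF \<rho>]
  have p: "pair ?\<rho> (fixv n F k ?\<rho>) \<in> ob (E (Suc n)) k"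
    unfolding ob_E_Suc using \<rho> IH by blast
  have "res D (Suc k) j (fixv n F (Suc k) \<rho>) = fixv n F j (res (E n) (Suc k) j \<rho>)"
    if "j \<le> Suc k" for j
  proof (cases j)
    case 0
    then show ?thesis using F(1)[OF p] by (simp add: constructors_res)
  next
    case (Suc i)
    then have i: "i \<le> k" using that by simp
    then show ?thesis using F(1)[OF p] F(2)[OF p i] IH \<rho> Suc Suc.prems
      by (simp add: constructors_res res_E_Suc del: Env.simps)
  qed
  then show ?case using F(1)[OF p] by (auto simp: constructors_in)
qed

text \<open>This makes the body of an abstraction an element of the exponential. The bound
  \<open>m\<close> may lie below the stage \<open>k\<close> of \<open>\<rho>\<close> because a
  closure stores its function delayed.\<close>

lemma curry_natural:
  assumes F: "\<And>k \<rho>. \<rho> \<in> ob (E (Suc n)) k \<Longrightarrow> F k \<rho> \<in> ob D k"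
    "\<And>k j \<rho>. \<rho> \<in> ob (E (Suc n)) k \<Longrightarrow> j \<le> k \<Longrightarrow> res D k j (F k \<rho>) = F j (res (E (Suc n)) k j \<rho>)"
    and \<rho>: "\<rho> \<in> ob (E n) k" "m \<le> k"
  shows "natural_upto D D m (\<lambda>j v. F j (pair (res (E n) k j \<rho>) v))"
proof -
  have "pair (res (E n) k j \<rho>) v \<in> ob (E (Suc n)) j" if "j \<le> m" "v \<in> ob D j" for j v
    unfolding ob_E_Suc using that \<rho> by simp
  then show ?thesis
    unfolding natural_upto_def using F \<rho> by (simp add: res_E_Suc del: Env.simps)
qed

text \<open>One induction carries both facts, since naturality of application, closures and fixed
  points is available only for arguments known to lie in the domain.\<close>

lemma den_natural:
  "in_Lambda n e \<Longrightarrow> \<rho> \<in> ob (E n) k \<Longrightarrow> den e n k \<rho> \<in> ob D k \<and>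
    (\<forall>j\<le>k. res D k j (den e n k \<rho>) = den e n j (res (E n) k j \<rho>))"
proof (induction e arbitrary: n k \<rho>)
  case LUnit
  then show ?case by (simp add: constructors_in constructors_res)
next
  case (LVar i)
  then show ?case by (simp add: lookupv_in lookupv_res)
next
  case (LApp t u)
  then show ?case by (simp add: ap_in ap_res)
next
  case (LLam t)
  have t: "in_Lambda (Suc n) t" using LLam.prems by simp
  show ?case
  proof (cases k)
    case 0
    then show ?thesis using LLam.prems by (simp add: constructors_in constructors_res)
  next
    case (Suc m)
    let ?\<phi> = "\<lambda>j v. den t (Suc n) j (pair (res (E n) k j \<rho>) v)"
    have \<phi>: "natural_upto D D m ?\<phi>"
      by (rule curry_natural) (use LLam.IH[OF t] LLam.prems(2) Suc in auto)
    then have \<phi>_in: "famv D m ?\<phi> \<in> ob (exp_obj D D) m" by auto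
    have "res D k j (den (LLam t) n k \<rho>) = den (LLam t) n j (res (E n) k j \<rho>)"
      if "j \<le> k" for j
    proof (cases j)
      case 0
      then show ?thesis using \<phi>_in Suc by (simp add: constructors_res del: ob_exp)
    next
      case (Suc i)
      then show ?thesis using \<phi>_in \<phi> \<open>k = Suc m\<close> that LLam.prems(2)
        by (auto simp: constructors_res famv_eq_iff simp del: ob_exp
            intro!: arg_cong[of _ _ "closure _"])
    qed
    then show ?thesis using \<phi>_in Suc by (auto simp: constructors_in simp del: ob_exp)
  qed
next
  case (LFix t)
  then have t: "in_Lambda (Suc n) t" by simp
  show ?case
    using fixv_natural[of n "den t (Suc n)" \<rho> k] LFix.IH[OF t] LFix.prems(2) by simp
qed

subsection \<open>Weakening, substitution and reduction\<close>

text \<open>Entry 0 is the last component, so a positive position recurses into the first one.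
  Insertion is the semantic counterpart of both \<open>llift c\<close> and
  \<open>lsubst_at c\<close>.\<close>

primrec insv :: "nat \<Rightarrow> 'u \<Rightarrow> 'u \<Rightarrow> 'u" where
  "insv 0 v \<rho> = pair \<rho> v"
| "insv (Suc c) v \<rho> = pair (insv c v (fstv \<rho>)) (sndv \<rho>)"

lemma insv_in: "c \<le> n \<Longrightarrow> \<rho> \<in> ob (E n) k \<Longrightarrow> v \<in> ob D k \<Longrightarrow> insv c v \<rho> \<in> ob (E (Suc n)) k"
proof (induction c arbitrary: n \<rho>)
  case 0
  then show ?case by (simp add: Dom_def)
next
  case (Suc c)
  then obtain m where "n = Suc m" by (cases n) auto
  then show ?case using Suc by (auto simp: Dom_def)
qed

lemma insv_res: "c \<le> n \<Longrightarrow> \<rho> \<in> ob (E n) k \<Longrightarrow> v \<in> ob D k \<Longrightarrow> j \<le> k \<Longrightarrow>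
    res (E (Suc n)) k j (insv c v \<rho>) = insv c (res D k j v) (res (E n) k j \<rho>)"
proof (induction c arbitrary: n \<rho>)
  case 0
  then show ?case by (simp add: Dom_def)
next
  case (Suc c)
  then obtain m where m: "n = Suc m" "c \<le> m" by (cases n) auto
  obtain \<rho>' w where \<rho>: "\<rho> = pair \<rho>' w" "\<rho>' \<in> ob (E m) k" "w \<in> ob D k"
    using Suc.prems(2) ob_E_Suc[of m k] unfolding m(1) by blast
  show ?case
    using Suc.IH[OF m(2) \<rho>(2) Suc.prems(3,4)] insv_in[OF m(2) \<rho>(2) Suc.prems(3)] m \<rho> Suc.prems
    by (simp add: res_E_Suc del: Env.simps)
qed

lemma lookupv_insv:
  "lookupv i (insv c v \<rho>) =
    (if i < c then lookupv i \<rho> else if i = c then v else lookupv (i - 1) \<rho>)"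
proof (induction c arbitrary: i \<rho>)
  case 0
  then show ?case by (cases i) auto
next
  case (Suc c)
  show ?case
  proof (cases i)
    case (Suc i')
    then show ?thesis by (cases i') (auto simp: Suc.IH)
  qed simp
qed

text \<open>A fixed point depends on the restrictions of its environment to all earlier stages, so
  environments are compared through a relation \<open>Q\<close> stable under restriction.\<close>

lemma fixv_cong:
  assumes F: "\<And>k \<rho> \<rho>' v. Q k \<rho> \<rho>' \<Longrightarrow> v \<in> ob D k \<Longrightarrow> F k (pair \<rho> v) = F' k (pair \<rho>' v)"
    and "in": "\<And>k \<rho> \<rho>'. Q k \<rho> \<rho>' \<Longrightarrow> fixv n F k \<rho> \<in> ob D k"
    and Q: "\<And>k j \<rho> \<rho>'. Q k \<rho> \<rho>' \<Longrightarrow> j \<le> k \<Longrightarrow> Q j (res (E n) k j \<rho>) (res (E n') k j \<rho>')"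
  shows "Q k \<rho> \<rho>' \<Longrightarrow> fixv n F k \<rho> = fixv n' F' k \<rho>'"
proof (induction k arbitrary: \<rho> \<rho>')
  case (Suc k)
  note r = Q[OF Suc.prems, of k, simplified]
  show ?case using F[OF r "in"[OF r]] Suc.IH[OF r] by simp
qed simp

lemma den_LLam_cong:
  assumes F: "\<And>k \<rho> \<rho>' v. Q k \<rho> \<rho>' \<Longrightarrow> v \<in> ob D k \<Longrightarrow>
      den t (Suc n) k (pair \<rho> v) = den t' (Suc n') k (pair \<rho>' v)"
    and Q: "\<And>k j \<rho> \<rho>'. Q k \<rho> \<rho>' \<Longrightarrow> j \<le> k \<Longrightarrow> Q j (res (E n) k j \<rho>) (res (E n') k j \<rho>')"
    and r: "Q k \<rho> \<rho>'"
  shows "den (LLam t) n k \<rho> = den (LLam t') n' k \<rho>'"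
  using F[OF Q[OF r]] by (auto split: nat.split simp: famv_eq_iff intro!: arg_cong[of _ _ "closure _"])

text \<open>Under a binder a value \<open>w\<close> is appended, and
  \<open>pair (insv c v \<rho>) w\<close> is \<open>insv (Suc c) v (pair \<rho> w)\<close>: the
  cutoff rises together with the environment.\<close>

lemma den_llift:
  assumes "in_Lambda n e" "c \<le> n" "\<rho> \<in> ob (E n) k" "v \<in> ob D k"
  shows "den (llift c e) (Suc n) k (insv c v \<rho>) = den e n k \<rho>"
  using assms
proof (induction e arbitrary: n c k \<rho> v)
  case (LVar i)
  then show ?case by (simp add: lookupv_insv)
next
  case (LLam t)
  \<comment> \<open>The inserted value is quantified inside \<open>Q\<close> because restricting the
    environment restricts it too.\<close>
  define Q where "Q k \<rho>' \<rho> \<longleftrightarrow> (\<exists>v\<in>ob D k. \<rho> \<in> ob (E n) k \<and> \<rho>' = insv c v \<rho>)" for k \<rho>' \<rho>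
  have "den (LLam (llift (Suc c) t)) (Suc n) k (insv c v \<rho>) = den (LLam t) n k \<rho>"
  proof (rule den_LLam_cong[of Q])
    fix k \<rho>' \<rho> w assume "Q k \<rho>' \<rho>" and w: "w \<in> ob D k"
    then obtain v where v: "v \<in> ob D k" "\<rho> \<in> ob (E n) k" "\<rho>' = insv c v \<rho>"
      by (auto simp: Q_def)
    then have "pair \<rho> w \<in> ob (E (Suc n)) k" unfolding ob_E_Suc using w by blast
    from LLam.IH[OF _ _ this v(1), of "Suc c"] LLam.prems
    show "den (llift (Suc c) t) (Suc (Suc n)) k (pair \<rho>' w) = den t (Suc n) k (pair \<rho> w)"
      by (simp add: v(3))
  next
    fix k j \<rho>' \<rho> assume "Q k \<rho>' \<rho>" "j \<le> k"
    then show "Q j (res (E (Suc n)) k j \<rho>') (res (E n) k j \<rho>)"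
      unfolding Q_def using insv_res LLam.prems by (metis res_in)
  next
    show "Q k (insv c v \<rho>) \<rho>" using LLam.prems by (auto simp: Q_def)
  qed
  then show ?case by (simp del: den.simps)
next
  case (LFix t)
  define Q where "Q k \<rho> \<rho>' \<longleftrightarrow> (\<exists>v\<in>ob D k. \<rho> \<in> ob (E n) k \<and> \<rho>' = insv c v \<rho>)" for k \<rho> \<rho>'
  \<comment> \<open>\<open>fixv_cong\<close> asks for membership of the left fixed point only, so
    the original term, whose scoping is assumed, stands there.\<close>
  have "fixv n (den t (Suc n)) k \<rho> = fixv (Suc n) (den (llift (Suc c) t) (Suc (Suc n))) k (insv c v \<rho>)"
  proof (rule fixv_cong[of Q])
    fix k \<rho> \<rho>' w assume "Q k \<rho> \<rho>'" and w: "w \<in> ob D k"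
    then obtain v where v: "v \<in> ob D k" "\<rho> \<in> ob (E n) k" "\<rho>' = insv c v \<rho>"
      by (auto simp: Q_def)
    then have "pair \<rho> w \<in> ob (E (Suc n)) k" unfolding ob_E_Suc using w by blast
    from LFix.IH[OF _ _ this v(1), of "Suc c"] LFix.prems
    show "den t (Suc n) k (pair \<rho> w) = den (llift (Suc c) t) (Suc (Suc n)) k (pair \<rho>' w)"
      by (simp add: v(3))
  next
    fix k \<rho> \<rho>' assume "Q k \<rho> \<rho>'"
    then show "fixv n (den t (Suc n)) k \<rho> \<in> ob D k"
      using den_natural[OF LFix.prems(1)] by (auto simp: Q_def)
  next
    fix k j \<rho> \<rho>' assume "Q k \<rho> \<rho>'" "j \<le> k"
    then show "Q j (res (E n) k j \<rho>) (res (E (Suc n)) k j \<rho>')"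
      unfolding Q_def using insv_res LFix.prems by (metis res_in)
  next
    show "Q k \<rho> (insv c v \<rho>)" using LFix.prems by (auto simp: Q_def)
  qed
  then show ?case by simp
qed simp_all

lemma in_Lambda_llift: "in_Lambda n e \<Longrightarrow> in_Lambda (Suc n) (llift c e)"
  by (induction e arbitrary: n c) auto

text \<open>At a binder \<open>u\<close> is lifted, and \<open>den_llift\<close> at cutoff 0 shows
  that the lifted term ignores the new entry; the inserted value is still that of \<open>u\<close>
  in the old environment.\<close>

lemma den_lsubst_at:
  assumes "in_Lambda (Suc n) e" "in_Lambda n u" "c \<le> n" "\<rho> \<in> ob (E n) k"
  shows "den (lsubst_at c u e) n k \<rho> = den e (Suc n) k (insv c (den u n k \<rho>) \<rho>)"
  using assms
proof (induction e arbitrary: n c k \<rho> u)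
  case (LVar i)
  then show ?case by (simp add: lookupv_insv)
next
  case (LLam t)
  \<comment> \<open>Naturality of \<open>den\<close> for \<open>u\<close> makes this relation stable
    under restriction.\<close>
  define Q where "Q k \<rho> \<rho>' \<longleftrightarrow> \<rho> \<in> ob (E n) k \<and> \<rho>' = insv c (den u n k \<rho>) \<rho>" for k \<rho> \<rho>'
  have "den (LLam (lsubst_at (Suc c) (llift 0 u) t)) n k \<rho> =
      den (LLam t) (Suc n) k (insv c (den u n k \<rho>) \<rho>)"
  proof (rule den_LLam_cong[of Q])
    fix k \<rho> \<rho>' w assume "Q k \<rho> \<rho>'" and w: "w \<in> ob D k"
    then have r: "\<rho> \<in> ob (E n) k" "\<rho>' = insv c (den u n k \<rho>) \<rho>" by (auto simp: Q_def)
    then have p: "pair \<rho> w \<in> ob (E (Suc n)) k" unfolding ob_E_Suc using w by blast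
    from LLam.IH[OF _ in_Lambda_llift[OF LLam.prems(2)] _ p, of "Suc c" 0] LLam.prems
      den_llift[OF LLam.prems(2) _ r(1) w, of 0]
    show "den (lsubst_at (Suc c) (llift 0 u) t) (Suc n) k (pair \<rho> w) =
        den t (Suc (Suc n)) k (pair \<rho>' w)"
      by (simp add: r(2))
  next
    fix k j \<rho> \<rho>' assume "Q k \<rho> \<rho>'" "j \<le> k"
    then show "Q j (res (E n) k j \<rho>) (res (E (Suc n)) k j \<rho>')"
      using insv_res[OF LLam.prems(3)] den_natural[OF LLam.prems(2)] by (simp add: Q_def)
  next
    show "Q k \<rho> (insv c (den u n k \<rho>) \<rho>)" using LLam.prems by (auto simp: Q_def)
  qed
  then show ?case by (simp del: den.simps)
next
  case (LFix t)
  define Q where "Q k \<rho>' \<rho> \<longleftrightarrow> \<rho> \<in> ob (E n) k \<and> \<rho>' = insv c (den u n k \<rho>) \<rho>" for k \<rho>' \<rho>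
  have "fixv (Suc n) (den t (Suc (Suc n))) k (insv c (den u n k \<rho>) \<rho>) =
      fixv n (den (lsubst_at (Suc c) (llift 0 u) t) (Suc n)) k \<rho>"
  proof (rule fixv_cong[of Q])
    fix k \<rho>' \<rho> w assume "Q k \<rho>' \<rho>" and w: "w \<in> ob D k"
    then have r: "\<rho> \<in> ob (E n) k" "\<rho>' = insv c (den u n k \<rho>) \<rho>" by (auto simp: Q_def)
    then have p: "pair \<rho> w \<in> ob (E (Suc n)) k" unfolding ob_E_Suc using w by blast
    from LFix.IH[OF _ in_Lambda_llift[OF LFix.prems(2)] _ p, of "Suc c" 0] LFix.prems
      den_llift[OF LFix.prems(2) _ r(1) w, of 0]
    show "den t (Suc (Suc n)) k (pair \<rho>' w) =
        den (lsubst_at (Suc c) (llift 0 u) t) (Suc n) k (pair \<rho> w)"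
      by (simp add: r(2))
  next
    fix k \<rho>' \<rho> assume "Q k \<rho>' \<rho>"
    then have "\<rho>' \<in> ob (E (Suc n)) k"
      using insv_in[OF LFix.prems(3)] den_natural[OF LFix.prems(2)] by (simp add: Q_def)
    then show "fixv (Suc n) (den t (Suc (Suc n))) k \<rho>' \<in> ob D k"
      using den_natural[OF LFix.prems(1)] by auto
  next
    fix k j \<rho>' \<rho> assume "Q k \<rho>' \<rho>" "j \<le> k"
    then show "Q j (res (E (Suc n)) k j \<rho>') (res (E n) k j \<rho>)"
      using insv_res[OF LFix.prems(3)] den_natural[OF LFix.prems(2)] by (simp add: Q_def)
  next
    show "Q k (insv c (den u n k \<rho>) \<rho>) \<rho>" using LFix.prems by (auto simp: Q_def)
  qed
  then show ?case by simp
qed simp_all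

section \<open>Reduction steps on denotations\<close>

lemma in_Lambda_lsubst_at:
  "in_Lambda (Suc n) e \<Longrightarrow> in_Lambda n u \<Longrightarrow> c \<le> n \<Longrightarrow> in_Lambda n (lsubst_at c u e)"
  by (induction e arbitrary: n c u) (auto simp: in_Lambda_llift)

lemma in_Lambda_step: "step e e' \<Longrightarrow> in_Lambda n e \<Longrightarrow> in_Lambda n e'"
  by (induction rule: step.induct) (auto simp: lsubst_def in_Lambda_lsubst_at)

text \<open>Applying a closure and unfolding a fixed point each create exactly one thunk. For a step
  in head position the induction hypothesis makes the head a thunk, and \<open>ap\<close> moves the
  application inside it.\<close>

lemma den_step:
  assumes "step e e'" "in_Lambda n e" "\<rho> \<in> ob (E n) k"
  shows "den e n k \<rho> =
    thunk k (case k of 0 \<Rightarrow> star | Suc m \<Rightarrow> den e' n m (res (E n) k m \<rho>))"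
  using assms
proof (induction arbitrary: k \<rho> rule: step.induct)
  case (step_beta t u)
  then have t: "in_Lambda (Suc n) t" and u: "in_Lambda n u" by simp_all
  show ?case
  proof (cases k)
    case 0
    then show ?thesis using ap_step_constructors(4)[of star 0] by simp
  next
    case (Suc m)
    let ?\<rho> = "res (E n) k m \<rho>"
    let ?\<phi> = "\<lambda>j v. den t (Suc n) j (pair (res (E n) k j \<rho>) v)"
    have \<rho>: "?\<rho> \<in> ob (E n) m" using step_beta.prems Suc by simp
    have "natural_upto D D m ?\<phi>"
      by (rule curry_natural) (use den_natural[OF t] step_beta.prems(2) Suc in auto)
    then have \<phi>_in: "famv D m ?\<phi> \<in> ob (later_obj (exp_obj D D)) k" using Suc by auto
    \<comment> \<open>The body receives the restricted argument. By naturality this is the argument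
      evaluated at stage \<open>m\<close>, and the substitution lemma at index 0 yields the
      reduct.\<close>
    show ?thesis
      using den_lsubst_at[OF t u _ \<rho>, of 0] Suc den_natural[OF u step_beta.prems(2)]
        den_natural[OF u \<rho>] ap_step_constructors(4)[OF \<phi>_in]
      by (simp add: lsubst_def)
  qed
next
  case (step_app t t' u)
  then have t: "in_Lambda n t" and u: "in_Lambda n u" by simp_all
  show ?case
  proof (cases k)
    case 0
    then show ?thesis using step_app by (simp add: ap_step_constructors)
  next
    case (Suc m)
    have "den t' n m (res (E n) k m \<rho>) \<in> ob D m"
      using den_natural[OF in_Lambda_step[OF step_app.hyps t]] step_app.prems Suc by simp
    then show ?thesis
      using step_app.IH[OF t step_app.prems(2)] Suc den_natural[OF u step_app.prems(2)]
      by (simp add: ap_step_constructors)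
  qed
next
  case (step_fix t)
  then have t: "in_Lambda (Suc n) t" by simp
  show ?case
    using den_lsubst_at[OF t step_fix.prems(1), of 0] step_fix.prems
    by (cases k) (simp_all add: lsubst_def)
qed

subsection \<open>Evaluating the interpretation\<close>

lemma push_Cons: "push x \<gamma> = (x # hd \<gamma>) # tl \<gamma>"
  by (simp add: push_def)

text \<open>\<open>tm_sem\<close> of an application unfolds to \<open>evalv\<close>, hence this
  form. Closed terms have the same value in every context, so \<open>G\<close> and
  \<open>\<gamma>\<close> stay arbitrary, here and below.\<close>

lemma tm_sem_App_MK: "s \<in> ob S k \<Longrightarrow> evalv (tm_sem (MK D \<theta>) G k \<gamma>) k s = \<theta> k s"
  by (simp add: MK_def name_of_def del: ob_sum)

lemma tm_sem_App_PROJ: "d \<in> ob D k \<Longrightarrow> evalv (tm_sem (PROJ D \<theta>) G k \<gamma>) k d = unroll k d"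
  by (simp add: PROJ_def name_of_def unroll_def)

lemma tm_sem_num: "i \<in> elts nat_set \<Longrightarrow> evalv (tm_sem (num_tm D \<theta>) G k \<gamma>) k i = num k i"
  by (simp add: num_tm_def push_Cons num_def tm_sem_App_MK S_eq del: elts_nat_set)

lemma tm_sem_error: "evalv (tm_sem (error_tm D \<theta>) G k \<gamma>) k star = err k"
  by (simp add: error_tm_def push_Cons err_def tm_sem_App_MK S_eq)

lemma tm_sem_thunk:
  "w \<in> ob (later_obj D) k \<Longrightarrow> evalv (tm_sem (thunk_tm D \<theta>) G k \<gamma>) k w = thunk k w"
  by (simp add: thunk_tm_def push_Cons thunk_def tm_sem_App_MK S_eq Dom_def del: ob_later)

lemma tm_sem_lam:
  "g \<in> ob (later_obj (exp_obj D D)) k \<Longrightarrow> evalv (tm_sem (lam_tm D \<theta>) G k \<gamma>) k g = closure k g"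
  by (simp add: lam_tm_def push_Cons closure_def tm_sem_App_MK S_eq Dom_def del: ob_later ob_exp)

section \<open>Denotation of the application term\<close>

definition apv :: "nat \<Rightarrow> 'u" where
  "apv n = famv D n (\<lambda>j d. famv D j (\<lambda>i x. ap i (res D j i d) x))"

lemma apv_natural: "natural_upto D (exp_obj D D) n (\<lambda>j d. famv D j (\<lambda>i x. ap i (res D j i d) x))"
proof -
  have *: "natural_upto D D k (\<lambda>i x. ap i (res D k i d) x)" if "d \<in> ob D k" for k d
    using that by (auto simp: natural_upto_def ap_in ap_res)
  then show ?thesis
    unfolding natural_upto_def by (auto simp: * famv_eq_iff)
qed

lemma apv_in: "apv n \<in> ob (exp_obj D (exp_obj D D)) n"
  unfolding apv_def using apv_natural by auto

lemma apv_res: "k \<le> n \<Longrightarrow> res (exp_obj D (exp_obj D D)) n k (apv n) = apv k"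
  unfolding apv_def using apv_natural by simp

definition apply_case :: "'u tm" where
  "apply_case = Case (App (PROJ D \<theta>) (Var 0 1))
     (Lam (TDelta nat_set) (App (error_tm D \<theta>) (Dl unit_set star)))
     (Lam (rest1 D) (Case (Var 0 0)
       (Lam (TDelta unit_set) (App (error_tm D \<theta>) (Dl unit_set star)))
       (Lam (rest2 D) (Case (Var 0 0)
         (Lam (TLater (Dom D)) (App (thunk_tm D \<theta>)
           (Delay (App (App (Adv 1 (Var 0 5)) (Adv 1 (Var 0 0))) (Var 1 3)))))
         (Lam (TLater (TFun (Dom D) (Dom D))) (App (thunk_tm D \<theta>)
           (Delay (App (Adv 1 (Var 0 0)) (Var 1 3)))))))))"

lemma apply_tm_eq: "apply_tm D \<theta> =
    Fix (TFun (Dom D) (TFun (Dom D) (Dom D))) (Lam (Dom D) (Lam (Dom D) apply_case))"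
  by (simp add: apply_tm_def apply_case_def)

text \<open>The element in question is what the recursion variable \<open>\<mu>\<close> of
  \<open>apply_tm\<close> holds: the denotation one stage earlier.\<close>

lemma delayed_apv_in:
  "(case n of 0 \<Rightarrow> star | Suc m \<Rightarrow> apv m) \<in> ob (later_obj (exp_obj D (exp_obj D D))) n"
  using apv_in by (cases n) (auto simp del: ob_exp)

lemma res_delayed_apv: "k \<le> n \<Longrightarrow>
  res (later_obj (exp_obj D (exp_obj D D))) n k (case n of 0 \<Rightarrow> star | Suc m \<Rightarrow> apv m) =
    (case k of 0 \<Rightarrow> star | Suc m \<Rightarrow> apv m)"
  using delayed_apv_in[of n] apv_in apv_res by (cases k; cases n) (simp_all del: ob_exp)

text \<open>Only the first three slots are read, so the rest of the environment is arbitrary. The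
  nested \<open>Case\<close> terms follow the sum structure of \<open>unroll i d\<close> and thus
  reproduce \<open>ap_step\<close>.\<close>

lemma tm_sem_apply_case:
  assumes d: "d \<in> ob D i" and x: "x \<in> ob D i"
  shows "tm_sem apply_case ((Dom D # Dom D # TLater (TFun (Dom D) (TFun (Dom D) (Dom D))) # \<Gamma>) # G) i
    ((x # d # (case i of 0 \<Rightarrow> star | Suc m \<Rightarrow> apv m) # xs) # \<gamma>) = ap i d x"
  using d
proof (cases rule: dom_cases)
  case (num a)
  then show ?thesis using d
    by (cases i) (simp_all add: apply_case_def tm_sem_App_PROJ unroll_constructors tm_sem_error
        ap_step_constructors Dom_def push_Cons)
next
  case err
  then show ?thesis using d
    by (cases i) (simp_all add: apply_case_def tm_sem_App_PROJ unroll_constructors tm_sem_error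
        ap_step_constructors Dom_def push_Cons rest1_def)
next
  case (thunk w)
  show ?thesis
  proof (cases i)
    case 0
    then show ?thesis using thunk d
      by (simp add: apply_case_def tm_sem_App_PROJ unroll_constructors tm_sem_thunk
        ap_step_constructors Dom_def push_Cons rest1_def rest2_def)
  next
    case (Suc m)
    \<comment> \<open>The recursive call: \<open>Adv 1 (Var 0 5)\<close> reads \<open>\<mu>\<close>
      at stage \<open>Suc m\<close>, where it holds \<open>apv m\<close>.\<close>
    have "evalv (evalv (apv m) m w) m (res D i m x) = ap m w (res D i m x)"
      using thunk x Suc by (simp add: apv_def)
    moreover have "ap m w (res D i m x) \<in> ob D m"
      using thunk x Suc by (simp add: ap_in)
    ultimately show ?thesis using thunk d x apv_in Suc
      by (simp add: apply_case_def tm_sem_App_PROJ unroll_constructors tm_sem_thunk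
        ap_step_constructors Dom_def push_Cons rest1_def rest2_def del: ob_exp)
  qed
next
  case (closure g)
  show ?thesis
  proof (cases i)
    case 0
    then show ?thesis using closure d
      by (simp add: apply_case_def tm_sem_App_PROJ unroll_constructors tm_sem_thunk
        ap_step_constructors Dom_def push_Cons rest1_def rest2_def)
  next
    case (Suc m)
    then have "evalv g m (res D i m x) \<in> ob D m"
      using closure x evalv_in[of g D D m] by (simp del: ob_exp)
    then show ?thesis using closure d x Suc
      by (simp add: apply_case_def tm_sem_App_PROJ unroll_constructors tm_sem_thunk
        ap_step_constructors Dom_def push_Cons rest1_def rest2_def del: ob_exp)
  qed
qed

lemma tm_sem_apply: "tm_sem (apply_tm D \<theta>) G n \<gamma> = apv n"
proof -
  let ?T = "TFun (Dom D) (TFun (Dom D) (Dom D))"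
  \<comment> \<open>With the delayed \<open>apv\<close> for \<open>\<mu>\<close> the body returns
    \<open>apv\<close>. Since \<open>fix_sem\<close> at stage \<open>Suc n\<close> consults only
    stage \<open>n\<close>, induction on the stage then evaluates it.\<close>
  have body: "tm_sem (Lam (Dom D) (Lam (Dom D) apply_case)) (push (TLater ?T) G) k
      (push (case k of 0 \<Rightarrow> star | Suc m \<Rightarrow> apv m) \<gamma>) = apv k" for k \<gamma>
    using tm_sem_apply_case
    by (simp add: apv_def[of k] push_Cons famv_eq_iff res_delayed_apv Dom_def del: ob_exp)
  have "fix_sem (tm_sem (Lam (Dom D) (Lam (Dom D) apply_case)) (push (TLater ?T) G)) G n \<gamma> = apv n"
    by (induction n arbitrary: \<gamma>)
      (use body[of 0] body[of "Suc _"] in \<open>simp_all del: tm_sem.simps\<close>)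
  then show ?thesis by (simp add: apply_tm_eq del: tm_sem.simps(5))
qed

section \<open>Denotation of interpreted terms\<close>

lemma tm_sem_lookup: "tm_sem (lookup r i) G k \<gamma> = lookupv i (tm_sem r G k \<gamma>)"
  by (induction i arbitrary: r) simp_all

lemma tm_sem_interp:
  "in_Lambda n e \<Longrightarrow> tm_sem (interp D \<theta> e n) G k \<gamma> = famv (E n) k (den e n)"
proof (induction e arbitrary: n G k \<gamma>)
  case LUnit
  then show ?case by (simp add: famv_eq_iff tm_sem_num)
next
  case (LVar i)
  then show ?case by (simp add: famv_eq_iff tm_sem_lookup push_Cons)
next
  case (LApp t u)
  then show ?case
    by (simp add: famv_eq_iff tm_sem_apply push_Cons apv_def den_natural)
next
  case (LLam t)
  then have t: "in_Lambda (Suc n) t" by simp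
  have "natural_upto D D m (\<lambda>j v. den t (Suc n) j (pair (res (E n) k j \<rho>) v))"
    if "\<rho> \<in> ob (E n) k" "m \<le> k" for m k \<rho>
    by (rule curry_natural) (use den_natural[OF t] that in auto)
  then have in_later: "(case k of 0 \<Rightarrow> star | Suc m \<Rightarrow> famv D m
      (\<lambda>j v. den t (Suc n) j (pair (res (E n) k j \<rho>) v))) \<in> ob (later_obj (exp_obj D D)) k"
    if "\<rho> \<in> ob (E n) k" for k \<rho>
    using that by (cases k) auto
  have delay: "tm_sem (Delay (Lam (Dom D) (App (interp D \<theta> t (Suc n)) (Pair (Var 1 0) (Var 0 0)))))
      (push (Env D n) G) k (push \<rho> \<gamma>) =
      (case k of 0 \<Rightarrow> star | Suc m \<Rightarrow> famv D m
        (\<lambda>j v. den t (Suc n) j (pair (res (E n) k j \<rho>) v)))"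
    if "\<rho> \<in> ob (E n) k" for G k \<rho> \<gamma>
    using that by (auto simp: LLam.IH[OF t] push_Cons famv_eq_iff Dom_def split: nat.split)
  \<comment> \<open>The clause for \<open>Delay\<close> stays folded so that \<open>delay\<close>
    can rewrite the whole argument of \<open>lam_tm\<close>.\<close>
  show ?case
    using delay in_later by (simp add: famv_eq_iff tm_sem_lam del: tm_sem.simps(7))
next
  case (LFix t)
  then have t: "in_Lambda (Suc n) t" by simp
  let ?b = "App (thunk_tm D \<theta>)
     (Delay (App (interp D \<theta> t (Suc n)) (Pair (Var 1 1) (Adv 1 (Var 0 0)))))"
  \<comment> \<open>\<open>fix_sem\<close> and \<open>fixv\<close> recurse in parallel: under
    \<open>Delay\<close>, \<open>Var 1 1\<close> is the restricted environment and
    \<open>Adv 1 (Var 0 0)\<close> the value one stage earlier.\<close>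
  have "fix_sem (tm_sem ?b (push (TLater (Dom D)) (push (Env D n) G))) (push (Env D n) G) k
      (push \<rho> \<gamma>) = fixv n (den t (Suc n)) k \<rho>" if "\<rho> \<in> ob (E n) k" for G k \<rho> \<gamma>
    using that
  proof (induction k arbitrary: \<rho> \<gamma>)
    case 0
    then show ?case by (simp add: tm_sem_thunk)
  next
    case (Suc k)
    let ?\<rho> = "res (E n) (Suc k) k \<rho>"
    have \<rho>: "?\<rho> \<in> ob (E n) k" using Suc.prems by simp
    have f: "fixv n (den t (Suc n)) k ?\<rho> \<in> ob D k"
      using den_natural[OF LFix.prems \<rho>] by simp
    then have "den t (Suc n) k (pair ?\<rho> (fixv n (den t (Suc n)) k ?\<rho>)) \<in> ob D k"
      using den_natural[OF t] \<rho> unfolding ob_E_Suc by blast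
    \<comment> \<open>\<open>ctx_res\<close> of a pushed environment is a cons whose head is a cons;
      the instance brings the induction hypothesis to that shape.\<close>
    then show ?case
      using Suc.IH[OF \<rho>, of "_ # _", unfolded push_Cons list.sel] \<rho> f Suc.prems
      by (simp add: push_Cons tm_sem_thunk LFix.IH[OF t] Dom_def)
  qed
  then show ?case by (simp add: famv_eq_iff)
qed

subsection \<open>Typing of the interpretation\<close>

lemma global_element_MK: "global_element (ty_sem (TFun (Dom_sum D) (Dom D))) (name_of S \<theta>)"
proof -
  have "natural_upto S D n \<theta>" for n
    using roll_in roll_res by (auto simp: natural_upto_def simp del: ob_sum)
  then show ?thesis by (auto simp: global_element_def name_of_def Dom_def)
qed

lemma global_element_PROJ: "global_element (ty_sem (TFun (Dom D) (Dom_sum D))) (name_of D unroll)"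
proof -
  have "natural_upto D S n unroll" for n
    using unroll_in unroll_res by (auto simp: natural_upto_def simp del: ob_sum)
  then show ?thesis by (auto simp: global_element_def name_of_def Dom_def)
qed

lemma typed_MK: "G \<noteq> [] \<Longrightarrow> typed G (MK D \<theta>) (TFun (Dom_sum D) (Dom D))"
  unfolding MK_def using t_AxTm global_element_MK by blast

lemma typed_PROJ: "G \<noteq> [] \<Longrightarrow> typed G (PROJ D \<theta>) (TFun (Dom D) (Dom_sum D))"
  unfolding PROJ_def unroll_def[symmetric] using t_AxTm global_element_PROJ by blast

lemma typed_num: "typed (\<Gamma> # G) (num_tm D \<theta>) (TFun (TDelta nat_set) (Dom D))"
  unfolding num_tm_def
  \<comment> \<open>\<open>typed_MK\<close> first fixes the argument type as
    \<open>Dom_sum D\<close>, which is then unfolded to show the sum that \<open>t_Inl\<close>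
    expects.\<close>
  by (rule t_Lam t_App typed_MK | simp add: Dom_sum_def | rule t_Inl typed_Var)+

lemma typed_error: "typed (\<Gamma> # G) (error_tm D \<theta>) (TFun (TDelta unit_set) (Dom D))"
  unfolding error_tm_def
  by (rule t_Lam t_App typed_MK | simp add: Dom_sum_def rest1_def | rule t_Inr t_Inl typed_Var)+

lemma typed_thunk: "typed (\<Gamma> # G) (thunk_tm D \<theta>) (TFun (TLater (Dom D)) (Dom D))"
  unfolding thunk_tm_def
  by (rule t_Lam t_App typed_MK | simp add: Dom_sum_def rest1_def rest2_def
      | rule t_Inr t_Inl typed_Var)+

lemma typed_lam:
  "typed (\<Gamma> # G) (lam_tm D \<theta>) (TFun (TLater (TFun (Dom D) (Dom D))) (Dom D))"
  unfolding lam_tm_def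
  by (rule t_Lam t_App typed_MK | simp add: Dom_sum_def rest1_def rest2_def
      | rule t_Inr t_Inl typed_Var)+

lemma typed_apply: "typed (\<Gamma> # G) (apply_tm D \<theta>) (TFun (Dom D) (TFun (Dom D) (Dom D)))"
proof -
  let ?G = "(Dom D # Dom D # TLater (TFun (Dom D) (TFun (Dom D) (Dom D))) # \<Gamma>) # G"
  let ?L1 = "TLater (Dom D)" and ?L2 = "TLater (TFun (Dom D) (Dom D))"
  have error: "typed ((\<tau> # \<Gamma>) # G) (App (error_tm D \<theta>) (Dl unit_set star)) (Dom D)" for \<tau> \<Gamma> G
    by (rule t_App[OF typed_error] t_Dl | simp)+
  have thunk: "typed ((?L1 # rest2 D # rest1 D # hd ?G) # G) (App (thunk_tm D \<theta>)
      (Delay (App (App (Adv 1 (Var 0 5)) (Adv 1 (Var 0 0))) (Var 1 3)))) (Dom D)"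
    by (intro t_App[OF typed_thunk] t_Delay t_App t_Adv typed_Var) auto
  have lam: "typed ((?L2 # rest2 D # rest1 D # hd ?G) # G) (App (thunk_tm D \<theta>)
      (Delay (App (Adv 1 (Var 0 0)) (Var 1 3)))) (Dom D)"
    by (intro t_App[OF typed_thunk] t_Delay t_App t_Adv typed_Var) auto
  have "typed ?G apply_case (Dom D)"
    unfolding apply_case_def
    \<comment> \<open>The conclusion of \<open>t_Case\<close> does not mention the summand types, so
      they are supplied for the three nested distinctions.\<close>
    by (rule t_Case[where \<tau> = "TDelta nat_set" and \<sigma> = "rest1 D"]
        t_Case[where \<tau> = "TDelta unit_set" and \<sigma> = "rest2 D"]
        t_Case[where \<tau> = ?L1 and \<sigma> = ?L2]
        t_Lam error thunk[simplified] lam[simplified] t_App[OF typed_PROJ[unfolded Dom_sum_def]] typed_Var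
        | simp add: rest1_def[symmetric] rest2_def[symmetric] | simp add: rest1_def rest2_def)+
  then show ?thesis unfolding apply_tm_eq by (intro t_Fix t_Lam)
qed

lemma typed_lookup: "typed G r (Env D n) \<Longrightarrow> i < n \<Longrightarrow> typed G (lookup r i) (Dom D)"
proof (induction i arbitrary: n r)
  case 0
  then show ?case by (cases n) (auto intro: t_ProjR)
next
  case (Suc i)
  then obtain m where "n = Suc m" by (cases n) auto
  then show ?case using Suc by (auto intro: t_ProjL)
qed

lemma typed_interp: "in_Lambda n e \<Longrightarrow> typed (\<Gamma> # G) (interp D \<theta> e n) (TFun (Env D n) (Dom D))"
proof (induction e arbitrary: n \<Gamma> G)
  case LUnit
  then show ?case by (auto intro!: t_Lam t_App[OF typed_num] t_Dl)
next
  case (LVar i)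
  then show ?case by (auto intro!: t_Lam typed_lookup typed_Var)
next
  case (LApp t u)
  have var: "typed ((Env D n # \<Gamma>) # G) (Var 0 0) (Env D n)" by (rule typed_Var) simp_all
  from LApp.prems have "in_Lambda n t" "in_Lambda n u" by simp_all
  note IH = LApp.IH(1)[OF this(1)] LApp.IH(2)[OF this(2)]
  show ?case unfolding interp.simps
    by (rule t_Lam t_App[OF t_App[OF typed_apply]] t_App[OF IH(1) var] t_App[OF IH(2) var])+
next
  case (LLam t)
  then show ?case
    by (auto intro!: t_Lam t_App[OF typed_lam] t_Delay t_App[OF LLam.IH] t_Pair typed_Var)
next
  case (LFix t)
  then show ?case
    by (auto intro!: t_Lam t_Fix t_App[OF typed_thunk] t_Delay t_App[OF LFix.IH] t_Pair t_Adv typed_Var)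
qed

section \<open>From denotations to judgmental equality\<close>

lemma typed_redex: "in_Lambda n e \<Longrightarrow> typed [[Env D n]] (App (interp D \<theta> e n) (Var 0 0)) (Dom D)"
  by (rule t_App[OF typed_interp] typed_Var | simp)+

lemma typed_reduct: "in_Lambda n e \<Longrightarrow>
    typed [[Env D n]] (App (thunk_tm D \<theta>) (Delay (App (interp D \<theta> e n) (Var 1 0)))) (Dom D)"
  by (rule t_App[OF typed_thunk] t_Delay t_App[OF typed_interp] typed_Var | simp)+

lemma interp_step_jeq:
  assumes "step e e'" "in_Lambda n e"
  shows "jeq [[Env D n]] (App (interp D \<theta> e n) (Var 0 0))
    (App (thunk_tm D \<theta>) (Delay (App (interp D \<theta> e' n) (Var 1 0)))) (Dom D)"
proof (rule j_sem)
  note e' = in_Lambda_step[OF assms]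
  show "typed [[Env D n]] (App (interp D \<theta> e n) (Var 0 0)) (Dom D)"
    "typed [[Env D n]] (App (thunk_tm D \<theta>) (Delay (App (interp D \<theta> e' n) (Var 1 0)))) (Dom D)"
    by (fact typed_redex[OF assms(2)] typed_reduct[OF e'])+
  fix k \<gamma> assume "\<gamma> \<in> ctx_sem [[Env D n]] k"
  then obtain \<rho> where \<gamma>: "\<gamma> = [[\<rho>]]" and \<rho>: "\<rho> \<in> ob (E n) k"
    by (auto simp: list_all2_Cons2)
  have delay: "tm_sem (Delay (App (interp D \<theta> e' n) (Var 1 0))) [[Env D n]] k \<gamma> =
      (case k of 0 \<Rightarrow> star | Suc m \<Rightarrow> den e' n m (res (E n) k m \<rho>))"
    using \<rho> by (auto simp: \<gamma> tm_sem_interp[OF e'] split: nat.split)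
  \<comment> \<open>\<open>tm_sem_thunk\<close> evaluates only at genuine elements of the later
    object.\<close>
  have "(case k of 0 \<Rightarrow> star | Suc m \<Rightarrow> den e' n m (res (E n) k m \<rho>)) \<in> ob (later_obj D) k"
    using \<rho> den_natural[OF e'] by (cases k) auto
  then show "tm_sem (App (interp D \<theta> e n) (Var 0 0)) [[Env D n]] k \<gamma> =
      tm_sem (App (thunk_tm D \<theta>) (Delay (App (interp D \<theta> e' n) (Var 1 0)))) [[Env D n]] k \<gamma>"
    using delay \<rho> den_step[OF assms \<rho>]
    by (simp add: tm_sem_interp[OF assms(2)] tm_sem_thunk \<gamma> del: tm_sem.simps(7))
qed

end

theorem mainTheorem4:
  fixes D :: "'u::universe obj" and \<theta> :: "nat \<Rightarrow> 'u \<Rightarrow> 'u"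
    and n :: nat and e e' :: lam
  assumes "is_domain D \<theta>"
    and "e \<in> Lambda n" and "e' \<in> Lambda n"
    and "step e e'"
  shows "provable (All (Env D n)
           (Eq (Dom D) (App (interp D \<theta> e n) (Var 0 0))
              (App (thunk_tm D \<theta>) (Delay (App (interp D \<theta> e' n) (Var 1 0))))))"
proof -
  interpret semantic_domain D \<theta> by unfold_locales (rule assms(1))
  have e: "in_Lambda n e" "in_Lambda n e'" using assms(2,3) by (simp_all add: Lambda_def)
  let ?\<Phi> = "Eq (Dom D) (App (interp D \<theta> e n) (Var 0 0))
      (App (thunk_tm D \<theta>) (Delay (App (interp D \<theta> e' n) (Var 1 0))))"
  have typed: "typed [[Env D n]] ?\<Phi> TOmega"
    by (intro t_Eq typed_redex typed_reduct e)
  \<comment> \<open>The equality is proved for a generic environment in slot 0; the hypothesis list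
    is empty, so generalising has nothing to weaken.\<close>
  have "prov [[Env D n]] [[]] ?\<Phi>"
    by (rule p_jeq[OF _ interp_step_jeq[OF assms(4) e(1)]]) (use typed in \<open>simp add: wf_seq_def\<close>)
  moreover have "wf_seq [[]] [[]] (All (Env D n) ?\<Phi>)"
    using typed by (auto simp: wf_seq_def intro: t_All)
  ultimately show ?thesis
    unfolding provable_def by (intro p_AllI) simp_all
qed

end
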